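(* The $\mathbf B_n^\pm$-orbit of a cyclically ordered quiver $Q$ on $n$ vertices consists of all cyclically ordered quivers that can be obtained from $Q$ by a sequence of proper mutations, reversals, and wiggles.
   Context: Fix an $n$-element vertex set $V$. A quiver is a finite directed graph without loops or oriented 2-cycles; multiple arrows are allowed. Mutation $\mu_j$ of a quiver at a vertex $j$: for each path $i\to j\to k$ add an arrow $i\to k$; reverse all arrows incident to $j$; repeatedly remove oriented 2-cycles. A cyclic ordering $\sigma$ of $V$ is a linear ordering considered up to cyclic shifts ("clockwise" placement on a circle); the linear orderings in this class are called compatible with $\sigma$. A cyclically ordered quiver (COQ) $(Q,\sigma)$ is a quiver on $V$ with a cyclic ordering of $V$. A wiggle transforms $(Q,\sigma)$ into $(Q,\sigma')$ where $\sigma'$ is obtained from $\sigma$ by interchanging two vertices that are consecutive in $\sigma$ and not adjacent in $Q$. A reversal at a vertex $v$ reverses all arrows of $Q$ incident to $v$ and keeps the ordering. A path $i\to j\to k$ in $Q$ makes a right turn at $j$ if $\sigma=(\dots,i,\dots,j,\dots,k,\dots)$. A vertex $j$ is proper in $(Q,\sigma)$ if every oriented two-arrow path $i\to j\to k$ in $Q$ makes a right turn at $j$. Let $\operatorname{In}(j)$ (resp., $\operatorname{Out}(j)$) be the set of vertices $i$ with an arrow $i\to j$ (resp., $j\to i$) in $Q$. If $j$ is proper, the proper mutation $\mu_j(Q,\sigma)$ is the quiver $\mu_j(Q)$ with the cyclic ordering obtained from $\sigma$ by keeping the placement of all vertices other than $j$ and moving $j$ clockwise past all the vertices in $\operatorname{Out}(j)$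 (each exactly once) without passing any vertex in $\operatorname{In}(j)$ (well defined up to wiggles; for a sink or source $j$ the cyclic ordering does not change, up to wiggles). A linearly ordered quiver is a pair $(Q,\tau)$ of a quiver $Q$ on $V$ and a linear ordering $\tau=(v_1<\dots<v_n)$ of $V$; $\operatorname{LOQ}(n)$ is the set of all of them. Its unipotent companion is the unipotent upper-triangular matrix $U=(u_{ij})$ with $u_{ij}=-b_{ij}$ for $i<j$, where $b_{ij}$ is the signed number of arrows from $v_i$ to $v_j$ (number of arrows $v_i\to v_j$ minus number of arrows $v_j\to v_i$). The pair $(U,\tau)$ determines $(Q,\tau)$. The signed braid group is $\mathbf B_n^\pm=\mathbf B_n\rtimes\{\pm1\}^n$, where $\mathbf B_n$ is the braid group with Artin generators $\sigma_1,\dots,\sigma_{n-1}$, $\rho_i\in\{\pm1\}^n$ has $-1$ in position $i$ and $1$'s elsewhere, and $\rho_k\sigma_j=\sigma_j\rho_k$ for $k\notin\{j,j+1\}$, $\rho_j\sigma_j=\sigma_j\rho_{j+1}$, $\rho_{j+1}\sigma_j=\sigma_j\rho_j$. It acts on $\operatorname{LOQ}(n)$ as follows. The generator $\sigma_k$ sends $(U,\tau)$ to $(GUG^T,\tau')$, where $G=s_k(I-u_{k,k+1}E_{k+1,k})$, $E_{k+1,k}$ is the matrix unit with $1$ in row $k+1$, column $k$, $s_k$ is the permutation matrix of the transposition $(k,k+1)$, and $\tau'$ is obtained from $\tau$ by switching its $k$th and $(k+1)$st elements. The generator $\rho_i$ keeps $\tau$ and reverses all arrows of $Q$ incident to the $i$th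 vertex in $\tau$. The $\mathbf B_n^\pm$-orbit of a COQ $(Q,\sigma)$ is the orbit of $(Q,\tau)$ for any $\tau$ compatible with $\sigma$ (it does not depend on the choice of $\tau$); a COQ $(Q',\sigma')$ lies in this orbit if $(Q',\tau')$ does for $\tau'$ compatible with $\sigma'$. *)

theory Defs
  imports
    "HOL-Algebra.Group_Action"
    "HOL-Combinatorics.Transposition"
    "HOL-Library.Cardinality"
    "Jordan_Normal_Form.Matrix"
begin

section \<open>Quivers\<close>

text \<open>
  The vertex set \<open>V\<close> is \<open>UNIV :: 'v set\<close> for a finite type \<open>'v\<close>, so \<open>n = CARD('v)\<close>.
  A quiver is given by its arrow multiplicities: \<open>Q i j\<close> is the number of arrows from \<open>i\<close> to \<open>j\<close>.
\<close>

type_synonym 'v quiver = "'v \<Rightarrow> 'v \<Rightarrow> nat"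

definition quiver :: "'v quiver \<Rightarrow> bool" where
  "quiver Q \<longleftrightarrow> (\<forall>i. Q i i = 0) \<and> (\<forall>i j. Q i j = 0 \<or> Q j i = 0)"

definition arrow :: "'v quiver \<Rightarrow> 'v \<Rightarrow> 'v \<Rightarrow> bool" where
  "arrow Q i j \<longleftrightarrow> Q i j > 0"

definition adjacent :: "'v quiver \<Rightarrow> 'v \<Rightarrow> 'v \<Rightarrow> bool" where
  "adjacent Q i j \<longleftrightarrow> arrow Q i j \<or> arrow Q j i"

definition In :: "'v quiver \<Rightarrow> 'v \<Rightarrow> 'v set" where
  "In Q j = {i. arrow Q i j}"

definition Out :: "'v quiver \<Rightarrow> 'v \<Rightarrow> 'v set" where
  "Out Q j = {i. arrow Q j i}"

definition signed_arrows :: "'v quiver \<Rightarrow> 'v \<Rightarrow> 'v \<Rightarrow> int" where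
  "signed_arrows Q i j = int (Q i j) - int (Q j i)"

definition reverse_at :: "'v \<Rightarrow> 'v quiver \<Rightarrow> 'v quiver" where
  "reverse_at v Q = (\<lambda>i k. if i = v \<or> k = v then Q k i else Q i k)"

definition add_composite_arrows :: "'v \<Rightarrow> 'v quiver \<Rightarrow> 'v quiver" where
  "add_composite_arrows j Q = (\<lambda>i k. Q i k + Q i j * Q j k)"

text \<open>Truncated subtraction: removing 2-cycles leaves the excess of \<open>i \<rightarrow> k\<close> over \<open>k \<rightarrow> i\<close>.\<close>

definition cancel_2cycles :: "'v quiver \<Rightarrow> 'v quiver" where
  "cancel_2cycles Q = (\<lambda>i k. Q i k - Q k i)"

definition mutation :: "'v \<Rightarrow> 'v quiver \<Rightarrow> 'v quiver" where
  "mutation j Q = cancel_2cycles (reverse_at j (add_composite_arrows j Q))"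


section \<open>Cyclically ordered quivers\<close>

text \<open>
  A linear ordering \<open>v\<^sub>1 < \<dots> < v\<^sub>n\<close> is the list of its elements; a cyclic ordering is the set of
  the linear orderings compatible with it. Reading a list from left to right is the clockwise
  direction.
\<close>

definition linear_orderings :: "'v list set" where
  "linear_orderings = {\<tau>. distinct \<tau> \<and> set \<tau> = UNIV}"

definition cyclic_class :: "'v list \<Rightarrow> 'v list set" where
  "cyclic_class \<tau> = {rotate m \<tau> | m. True}"

definition cyclic_orderings :: "'v list set set" where
  "cyclic_orderings = cyclic_class ` linear_orderings"

type_synonym 'v coq = "'v quiver \<times> 'v list set"

definition COQ :: "'v coq set" where
  "COQ = {(Q, \<sigma>). quiver Q \<and> \<sigma> \<in> cyclic_orderings}"

inductive wiggle :: "'v coq \<Rightarrow> 'v coq \<Rightarrow> bool" where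
  "a # b # ys \<in> \<sigma> \<Longrightarrow> \<not> adjacent Q a b \<Longrightarrow> wiggle (Q, \<sigma>) (Q, cyclic_class (b # a # ys))"

inductive reversal :: "'v coq \<Rightarrow> 'v coq \<Rightarrow> bool" where
  "reversal (Q, \<sigma>) (reverse_at v Q, \<sigma>)"

definition right_turn :: "'v list set \<Rightarrow> 'v \<Rightarrow> 'v \<Rightarrow> 'v \<Rightarrow> bool" where
  "right_turn \<sigma> i j k \<longleftrightarrow> (\<exists>xs ys zs ws. xs @ [i] @ ys @ [j] @ zs @ [k] @ ws \<in> \<sigma>)"

definition proper :: "'v coq \<Rightarrow> 'v \<Rightarrow> bool" where
  "proper = (\<lambda>(Q, \<sigma>) j. \<forall>i k. arrow Q i j \<and> arrow Q j k \<longrightarrow> right_turn \<sigma> i j k)"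

text \<open>
  Proper mutation is well defined only up to wiggles, so it is a relation, allowing every
  admissible final position of \<open>j\<close>. The vertices that \<open>j\<close> passes are those in the list \<open>xs\<close>.
\<close>

inductive proper_mutation :: "'v \<Rightarrow> 'v coq \<Rightarrow> 'v coq \<Rightarrow> bool" for j where
  "proper (Q, \<sigma>) j \<Longrightarrow> j # xs @ ys \<in> \<sigma> \<Longrightarrow> Out Q j \<subseteq> set xs \<Longrightarrow> In Q j \<inter> set xs = {} \<Longrightarrow>
   proper_mutation j (Q, \<sigma>) (mutation j Q, cyclic_class (xs @ j # ys))"

definition coq_step :: "'v coq \<Rightarrow> 'v coq \<Rightarrow> bool" where
  "coq_step X Y \<longleftrightarrow> (\<exists>j. proper_mutation j X Y) \<or> reversal X Y \<or> wiggle X Y"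


section \<open>Linearly ordered quivers and the operators on them\<close>

text \<open>List positions and matrix indices start at 0, so \<open>\<sigma>\<^sub>k\<close> and \<open>\<rho>\<^sub>k\<close> have index \<open>k - 1\<close> below.\<close>

type_synonym 'v loq = "'v quiver \<times> 'v list"

definition LOQ :: "'v loq set" where
  "LOQ = {(Q, \<tau>). quiver Q \<and> \<tau> \<in> linear_orderings}"

definition companion :: "'v loq \<Rightarrow> int mat" where
  "companion = (\<lambda>(Q, \<tau>). mat (length \<tau>) (length \<tau>)
     (\<lambda>(i, j). if i < j then - signed_arrows Q (\<tau> ! i) (\<tau> ! j) else if i = j then 1 else 0))"

definition position :: "'v list \<Rightarrow> 'v \<Rightarrow> nat" where
  "position \<tau> v = (THE i. i < length \<tau> \<and> \<tau> ! i = v)"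

text \<open>
  The linearly ordered quiver with a given companion and ordering; that this inverts \<open>companion\<close>
  is shown in \<open>loq_of_companion\<close> and \<open>companion_loq_of\<close> below.
\<close>

definition loq_of :: "int mat \<Rightarrow> 'v list \<Rightarrow> 'v loq" where
  "loq_of U \<tau> = ((\<lambda>v w. let i = position \<tau> v; j = position \<tau> w in
      nat (if i < j then - U $$ (i, j) else if j < i then U $$ (j, i) else 0)), \<tau>)"

definition matrix_unit :: "nat \<Rightarrow> nat \<Rightarrow> nat \<Rightarrow> int mat" where
  "matrix_unit n p q = mat n n (\<lambda>(i, j). if i = p \<and> j = q then 1 else 0)"

definition transposition_mat :: "nat \<Rightarrow> nat \<Rightarrow> int mat" where
  "transposition_mat n k = mat n n (\<lambda>(i, j). if j = transpose k (Suc k) i then 1 else 0)"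

definition braid_matrix :: "nat \<Rightarrow> int mat \<Rightarrow> int mat" where
  "braid_matrix k U = (let n = dim_row U in
     transposition_mat n k * (1\<^sub>m n - U $$ (k, Suc k) \<cdot>\<^sub>m matrix_unit n (Suc k) k))"

definition switch :: "nat \<Rightarrow> 'v list \<Rightarrow> 'v list" where
  "switch k \<tau> = \<tau>[k := \<tau> ! Suc k, Suc k := \<tau> ! k]"

definition artin_op :: "nat \<Rightarrow> 'v loq \<Rightarrow> 'v loq" where
  "artin_op k = (\<lambda>(Q, \<tau>). let U = companion (Q, \<tau>); G = braid_matrix k U in
     loq_of (G * U * transpose_mat G) (switch k \<tau>))"

definition sign_op :: "nat \<Rightarrow> 'v loq \<Rightarrow> 'v loq" where
  "sign_op i = (\<lambda>(Q, \<tau>). (reverse_at (\<tau> ! i) Q, \<tau>))"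


section \<open>The signed braid group\<close>

text \<open>
  The semidirect product of the braid group and the sign group is presented by the generators and
  defining relations of the two factors together with the rules for moving a \<open>\<rho>\<^sub>k\<close> past a \<open>\<sigma>\<^sub>j\<close>.
  In words, a letter \<open>(g, True)\<close> stands for the generator \<open>g\<close> and \<open>(g, False)\<close> for its inverse.
\<close>

datatype sbgen = Artin nat | Sign nat

type_synonym sbword = "(sbgen \<times> bool) list"

definition sbgens :: "nat \<Rightarrow> sbgen set" where
  "sbgens n = {Artin k | k. Suc k < n} \<union> {Sign i | i. i < n}"

definition sbwords :: "nat \<Rightarrow> sbword set" where
  "sbwords n = lists (sbgens n \<times> UNIV)"

abbreviation artin :: "nat \<Rightarrow> sbgen \<times> bool" where "artin k \<equiv> (Artin k, True)"
abbreviation sign :: "nat \<Rightarrow> sbgen \<times> bool" where "sign i \<equiv> (Sign i, True)"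

inductive relator :: "nat \<Rightarrow> sbword \<Rightarrow> sbword \<Rightarrow> bool" for n where
  cancel: "g \<in> sbgens n \<Longrightarrow> relator n [(g, b), (g, \<not> b)] []"
| artin_far: "Suc i < j \<Longrightarrow> Suc j < n \<Longrightarrow> relator n [artin i, artin j] [artin j, artin i]"
| artin_braid: "Suc (Suc i) < n \<Longrightarrow>
    relator n [artin i, artin (Suc i), artin i] [artin (Suc i), artin i, artin (Suc i)]"
| sign_square: "i < n \<Longrightarrow> relator n [sign i, sign i] []"
| sign_comm: "i < n \<Longrightarrow> j < n \<Longrightarrow> relator n [sign i, sign j] [sign j, sign i]"
| cross_far: "k < n \<Longrightarrow> Suc j < n \<Longrightarrow> k \<notin> {j, Suc j} \<Longrightarrow>
    relator n [sign k, artin j] [artin j, sign k]"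
| cross_fst: "Suc j < n \<Longrightarrow> relator n [sign j, artin j] [artin j, sign (Suc j)]"
| cross_snd: "Suc j < n \<Longrightarrow> relator n [sign (Suc j), artin j] [artin j, sign j]"

inductive sbcong :: "nat \<Rightarrow> sbword \<Rightarrow> sbword \<Rightarrow> bool" for n where
  rel: "relator n v w \<Longrightarrow> sbcong n (x @ v @ y) (x @ w @ y)"
| refl: "sbcong n v v"
| sym: "sbcong n v w \<Longrightarrow> sbcong n w v"
| trans: "sbcong n u v \<Longrightarrow> sbcong n v w \<Longrightarrow> sbcong n u w"

definition sbeq :: "nat \<Rightarrow> (sbword \<times> sbword) set" where
  "sbeq n = {(v, w). v \<in> sbwords n \<and> w \<in> sbwords n \<and> sbcong n v w}"

definition signed_braid_group :: "nat \<Rightarrow> sbword set monoid" where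
  "signed_braid_group n = \<lparr>
     carrier = sbwords n // sbeq n,
     monoid.mult = \<lambda>A B. \<Union>v\<in>A. \<Union>w\<in>B. sbeq n `` {v @ w},
     one = sbeq n `` {[]}\<rparr>"


section \<open>The action on linearly ordered quivers and its orbits\<close>

fun gen_op :: "sbgen \<Rightarrow> 'v loq \<Rightarrow> 'v loq" where
  "gen_op (Artin k) = artin_op k"
| "gen_op (Sign i) = sign_op i"

definition gen_bij :: "sbgen \<Rightarrow> 'v loq \<Rightarrow> 'v loq" where
  "gen_bij g = restrict (gen_op g) LOQ"

definition letter_bij :: "sbgen \<times> bool \<Rightarrow> 'v loq \<Rightarrow> 'v loq" where
  "letter_bij = (\<lambda>(g, b). if b then gen_bij g else inv\<^bsub>BijGroup LOQ\<^esub> gen_bij g)"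

definition word_bij :: "sbword \<Rightarrow> 'v loq \<Rightarrow> 'v loq" where
  "word_bij w = foldr (\<lambda>l f. letter_bij l \<otimes>\<^bsub>BijGroup LOQ\<^esub> f) w \<one>\<^bsub>BijGroup LOQ\<^esub>"

text \<open>All words in one element of the group act by the same bijection: see \<open>sbeq_word_bij\<close> below.\<close>

definition signed_braid_action :: "sbword set \<Rightarrow> 'v loq \<Rightarrow> 'v loq" where
  "signed_braid_action c = the_elem (word_bij ` c)"

definition loq_orbit :: "'v::finite loq \<Rightarrow> 'v loq set" where
  "loq_orbit X = orbit (signed_braid_group CARD('v)) signed_braid_action X"

text \<open>Independence of the compatible linear orderings is shown in \<open>coq_orbit_iff\<close> below.\<close>

definition coq_orbit :: "'v::finite coq \<Rightarrow> 'v coq set" where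
  "coq_orbit = (\<lambda>(Q, \<sigma>). {(Q', \<sigma>') \<in> COQ. \<exists>\<tau>\<in>\<sigma>. \<exists>\<tau>'\<in>\<sigma>'. (Q', \<tau>') \<in> loq_orbit (Q, \<tau>)})"


section \<open>The operators are well defined\<close>

lemma linear_orderings_iff: "\<tau> \<in> linear_orderings \<longleftrightarrow> distinct \<tau> \<and> set \<tau> = UNIV"
  by (simp add: linear_orderings_def)

lemma length_linear_ordering: "(\<tau> :: 'v list) \<in> linear_orderings \<Longrightarrow> length \<tau> = CARD('v)"
  by (metis linear_orderings_iff distinct_card)

lemma position_nth: "\<tau> \<in> linear_orderings \<Longrightarrow> i < length \<tau> \<Longrightarrow> position \<tau> (\<tau> ! i) = i"
  unfolding position_def linear_orderings_iff
  by (rule the_equality) (auto simp: nth_eq_iff_index_eq)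

lemma position:
  assumes "\<tau> \<in> linear_orderings"
  shows "position \<tau> v < length \<tau>" "\<tau> ! position \<tau> v = v"
proof -
  obtain i where "i < length \<tau>" "\<tau> ! i = v"
    using assms by (metis UNIV_I in_set_conv_nth linear_orderings_iff)
  thus "position \<tau> v < length \<tau>" "\<tau> ! position \<tau> v = v"
    using position_nth[OF assms] by auto
qed

lemma position_eq_iff: "\<tau> \<in> linear_orderings \<Longrightarrow> position \<tau> v = position \<tau> w \<longleftrightarrow> v = w"
  by (metis position(2))

lemma position_less_cases:
  assumes "\<tau> \<in> linear_orderings"
  obtains "v = w" | "v \<noteq> w" "position \<tau> v < position \<tau> w" | "v \<noteq> w" "position \<tau> w < position \<tau> v"
  using position_eq_iff[OF assms] by (metis nat_neq_iff)

lemma length_switch [simp]: "length (switch k \<tau>) = length \<tau>"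
  by (simp add: switch_def)

lemma nth_switch:
  "Suc k < length \<tau> \<Longrightarrow> i < length \<tau> \<Longrightarrow> switch k \<tau> ! i = \<tau> ! transpose k (Suc k) i"
  by (auto simp: switch_def nth_list_update transpose_def)

lemma switch_linear:
  assumes "\<tau> \<in> linear_orderings" "Suc k < length \<tau>"
  shows "switch k \<tau> \<in> linear_orderings"
  using assms unfolding linear_orderings_iff switch_def
  by (metis Suc_lessD distinct_swap set_swap)

lemma position_switch:
  assumes "\<tau> \<in> linear_orderings" "Suc k < length \<tau>"
  shows "position (switch k \<tau>) v = transpose k (Suc k) (position \<tau> v)"
proof -
  let ?i = "transpose k (Suc k) (position \<tau> v)"
  have l: "?i < length \<tau>"
    using assms position(1)[OF assms(1), of v] by (auto simp: transpose_def)
  have "switch k \<tau> ! ?i = v"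
    using nth_switch[OF assms(2) l] position(2)[OF assms(1)] by simp
  thus ?thesis
    using position_nth[OF switch_linear[OF assms], of ?i] l by simp
qed

text \<open>
  The companion indexed by vertices rather than positions is the Gram matrix of a bilinear form
  \<open>f\<close> in which \<open>\<sigma>\<^sub>k\<close> replaces the basis vector \<open>y\<close> by \<open>y - f x y x\<close>, where \<open>x\<close> and \<open>y\<close> are the
  vertices that it switches.
\<close>

type_synonym 'v form = "'v \<Rightarrow> 'v \<Rightarrow> int"

definition unitri :: "'v form \<times> 'v list \<Rightarrow> bool" where
  "unitri = (\<lambda>(f, \<tau>). \<tau> \<in> linear_orderings \<and> (\<forall>v. f v v = 1) \<and>
     (\<forall>v w. position \<tau> w < position \<tau> v \<longrightarrow> f v w = 0))"

definition enc :: "'v loq \<Rightarrow> 'v form \<times> 'v list" where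
  "enc = (\<lambda>(Q, \<tau>). (\<lambda>v w. if v = w then 1
     else if position \<tau> v < position \<tau> w then - signed_arrows Q v w else 0, \<tau>))"

definition dec :: "'v form \<times> 'v list \<Rightarrow> 'v loq" where
  "dec = (\<lambda>(f, \<tau>). (\<lambda>v w. nat (if position \<tau> v < position \<tau> w then - f v w
     else if position \<tau> w < position \<tau> v then f w v else 0), \<tau>))"

definition transvect :: "int \<Rightarrow> 'v \<Rightarrow> 'v \<Rightarrow> 'v form \<Rightarrow> 'v form" where
  "transvect c x y f = (\<lambda>v w. f v w - (if v = y then c * f x w else 0)
     - (if w = y then c * f v x else 0) + (if v = y \<and> w = y then c * c * f x x else 0))"

definition artin_form :: "nat \<Rightarrow> 'v form \<times> 'v list \<Rightarrow> 'v form \<times> 'v list" where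
  "artin_form k = (\<lambda>(f, \<tau>). let x = \<tau> ! k; y = \<tau> ! Suc k in
     (transvect (f x y) x y f, switch k \<tau>))"

definition artin_form_inv :: "nat \<Rightarrow> 'v form \<times> 'v list \<Rightarrow> 'v form \<times> 'v list" where
  "artin_form_inv k = (\<lambda>(f, \<tau>). let y = \<tau> ! k; x = \<tau> ! Suc k in
     (transvect (f y x) x y f, switch k \<tau>))"

definition sign_form :: "nat \<Rightarrow> 'v form \<times> 'v list \<Rightarrow> 'v form \<times> 'v list" where
  "sign_form i = (\<lambda>(f, \<tau>). (\<lambda>v w. if (v = \<tau> ! i) = (w = \<tau> ! i) then f v w else - f v w, \<tau>))"

lemma unitri_enc: "X \<in> LOQ \<Longrightarrow> unitri (enc X)"
  by (auto simp: LOQ_def enc_def unitri_def)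

lemma dec_LOQ: "unitri Y \<Longrightarrow> dec Y \<in> LOQ"
  by (cases Y) (auto simp: LOQ_def dec_def unitri_def quiver_def)

lemma dec_enc:
  assumes "X \<in> LOQ"
  shows "dec (enc X) = X"
proof -
  obtain Q \<tau> where X: "X = (Q, \<tau>)" "quiver Q" "\<tau> \<in> linear_orderings"
    using assms by (auto simp: LOQ_def)
  have "fst (dec (enc X)) v w = Q v w" for v w
  proof -
    have "Q v v = 0" "Q v w = 0 \<or> Q w v = 0" using X(2) by (auto simp: quiver_def)
    thus ?thesis
      by (cases rule: position_less_cases[OF X(3), of v w])
        (auto simp: X(1) dec_def enc_def signed_arrows_def)
  qed
  thus ?thesis by (auto simp: X(1) dec_def enc_def)
qed

lemma enc_dec:
  assumes "unitri Y"
  shows "enc (dec Y) = Y"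
proof -
  obtain f \<tau> where Y: "Y = (f, \<tau>)" by (cases Y)
  have lin: "\<tau> \<in> linear_orderings" using assms by (auto simp: Y unitri_def)
  have "fst (enc (dec Y)) v w = f v w" for v w
    using assms by (cases rule: position_less_cases[OF lin, of v w])
      (auto simp: Y dec_def enc_def signed_arrows_def unitri_def)
  thus ?thesis by (auto simp: Y dec_def enc_def)
qed

lemma companion_position:
  assumes "(Q, \<tau>) \<in> LOQ"
  shows "companion (Q, \<tau>) $$ (position \<tau> v, position \<tau> w) = fst (enc (Q, \<tau>)) v w"
proof -
  have lin: "\<tau> \<in> linear_orderings" using assms by (auto simp: LOQ_def)
  show ?thesis
    by (simp add: companion_def enc_def position[OF lin] position_eq_iff[OF lin])
qed

lemma loq_of_dec: "loq_of U \<tau> = dec (\<lambda>v w. U $$ (position \<tau> v, position \<tau> w), \<tau>)"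
  by (simp add: loq_of_def dec_def Let_def)

lemma loq_of_companion: "(Q, \<tau>) \<in> LOQ \<Longrightarrow> loq_of (companion (Q, \<tau>)) \<tau> = (Q, \<tau>)"
  using companion_position[of Q \<tau>] dec_enc[of "(Q, \<tau>)"]
  by (simp add: loq_of_dec enc_def)

lemma companion_loq_of:
  assumes "\<tau> \<in> linear_orderings" "U \<in> carrier_mat (length \<tau>) (length \<tau>)"
    "\<And>i. i < length \<tau> \<Longrightarrow> U $$ (i, i) = 1"
    "\<And>i j. j < i \<Longrightarrow> i < length \<tau> \<Longrightarrow> U $$ (i, j) = 0"
  shows "loq_of U \<tau> \<in> LOQ" "companion (loq_of U \<tau>) = U"
proof -
  have u: "unitri (\<lambda>v w. U $$ (position \<tau> v, position \<tau> w), \<tau>)"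
    using assms position(1)[OF assms(1)] by (auto simp: unitri_def)
  show L: "loq_of U \<tau> \<in> LOQ" using dec_LOQ[OF u] by (simp add: loq_of_dec)
  obtain Q where Q: "loq_of U \<tau> = (Q, \<tau>)" by (simp add: loq_of_def)
  have *: "companion (Q, \<tau>) $$ (position \<tau> v, position \<tau> w) = U $$ (position \<tau> v, position \<tau> w)" for v w
    using companion_position[of Q \<tau> v w] L enc_dec[OF u] Q
    by (metis fst_conv loq_of_dec)
  show "companion (loq_of U \<tau>) = U"
  proof (rule eq_matI)
    fix i j assume "i < dim_row U" "j < dim_col U"
    thus "companion (loq_of U \<tau>) $$ (i, j) = U $$ (i, j)"
      using *[of "\<tau> ! i" "\<tau> ! j"] assms(2) by (simp add: Q position_nth[OF assms(1)])
  qed (use assms(2) in \<open>auto simp: Q companion_def\<close>)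
qed


lemma braid_matrix_mult:
  assumes "U \<in> carrier_mat n n" "X \<in> carrier_mat n n" "Suc k < n" "i < n" "j < n"
  shows "(braid_matrix k U * X) $$ (i, j) = X $$ (transpose k (Suc k) i, j) -
    (if transpose k (Suc k) i = Suc k then U $$ (k, Suc k) * X $$ (k, j) else 0)"
proof -
  let ?s = "transpose k (Suc k)"
  have S: "(transposition_mat n k * Y) $$ (i, j) = Y $$ (?s i, j)" if "Y \<in> carrier_mat n n" for Y
  proof -
    have "?s i < n" using assms by (auto simp: transpose_def)
    thus ?thesis
      using assms that
      by (simp add: transposition_mat_def scalar_prod_def if_distrib[of "\<lambda>x. x * _"] cong: if_cong)
  qed
  have E: "(matrix_unit n (Suc k) k * X) $$ (p, j) = (if p = Suc k then X $$ (k, j) else 0)"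
    if "p < n" for p
    using assms that
    by (simp add: matrix_unit_def scalar_prod_def if_distrib[of "\<lambda>x. x * _"] cong: if_cong)
  let ?E = "matrix_unit n (Suc k) k"
  let ?A = "1\<^sub>m n - U $$ (k, Suc k) \<cdot>\<^sub>m ?E"
  have c: "?E \<in> carrier_mat n n" "transposition_mat n k \<in> carrier_mat n n"
    by (simp_all add: matrix_unit_def transposition_mat_def)
  have A: "?A * X = X - U $$ (k, Suc k) \<cdot>\<^sub>m (?E * X)"
    using c assms by (subst minus_mult_distrib_mat[of _ n n _ _ n]) auto
  have "braid_matrix k U * X = transposition_mat n k * (?A * X)"
    unfolding braid_matrix_def Let_def carrier_matD(1)[OF assms(1)]
    by (rule assoc_mult_mat[of _ n n _ n _ n]) (use c assms in auto)
  moreover have "?s i < n" using assms by (auto simp: transpose_def)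
  moreover have "?A * X \<in> carrier_mat n n"
    unfolding A by (intro minus_carrier_mat smult_carrier_mat mult_carrier_mat[of _ n n] c assms(2))
  ultimately have "(braid_matrix k U * X) $$ (i, j) = (?A * X) $$ (?s i, j)"
    using S[of "?A * X"] by simp
  also have "\<dots> = X $$ (?s i, j) - U $$ (k, Suc k) * (?E * X) $$ (?s i, j)"
    unfolding A using c assms \<open>?s i < n\<close> by (simp del: index_mult_mat(1))
  finally show ?thesis
    using E[OF \<open>?s i < n\<close>] by simp
qed

lemma braid_matrix_congruence:
  assumes U: "U \<in> carrier_mat n n" and k: "Suc k < n" and ij: "i < n" "j < n"
  defines "s \<equiv> transpose k (Suc k)" and "u \<equiv> U $$ (k, Suc k)" and "G \<equiv> braid_matrix k U"
  shows "(G * U * transpose_mat G) $$ (i, j) = U $$ (s i, s j)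
    - (if s i = Suc k then u * U $$ (k, s j) else 0)
    - (if s j = Suc k then u * U $$ (s i, k) else 0)
    + (if s i = Suc k \<and> s j = Suc k then u * u * U $$ (k, k) else 0)"
proof -
  have c: "matrix_unit n (Suc k) k \<in> carrier_mat n n" "transposition_mat n k \<in> carrier_mat n n"
    by (simp_all add: matrix_unit_def transposition_mat_def)
  hence G: "G \<in> carrier_mat n n"
    unfolding G_def braid_matrix_def Let_def carrier_matD(1)[OF U]
    by (intro mult_carrier_mat[of _ n n] minus_carrier_mat smult_carrier_mat)
  have s: "s j < n" "s i < n" using ij k by (auto simp: s_def transpose_def)
  have GU: "G * U \<in> carrier_mat n n" using G U by simp
  have "G * U * transpose_mat G = transpose_mat (G * transpose_mat (G * U))"
    using G U transpose_mult[OF G, of "transpose_mat (G * U)" n] by simp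
  hence "(G * U * transpose_mat G) $$ (i, j) = (G * transpose_mat (G * U)) $$ (j, i)"
    using G U ij by simp
  also have "\<dots> = transpose_mat (G * U) $$ (s j, i) -
     (if s j = Suc k then u * transpose_mat (G * U) $$ (k, i) else 0)"
    unfolding G_def s_def u_def
    by (rule braid_matrix_mult) (use U k ij GU in \<open>auto simp: G_def\<close>)
  also have "\<dots> = (G * U) $$ (i, s j) - (if s j = Suc k then u * (G * U) $$ (i, k) else 0)"
    using GU ij(1) s(1) Suc_lessD[OF k] by (simp add: carrier_matD[OF GU] del: index_mult_mat)
  also have "(G * U) $$ (i, s j) = U $$ (s i, s j) - (if s i = Suc k then u * U $$ (k, s j) else 0)"
    using braid_matrix_mult[OF U U k ij(1) s(1)] by (simp add: G_def s_def u_def)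
  also have "(G * U) $$ (i, k) = U $$ (s i, k) - (if s i = Suc k then u * U $$ (k, k) else 0)"
    using braid_matrix_mult[OF U U k ij(1), of k] k by (simp add: G_def s_def u_def)
  finally show ?thesis by (auto simp: algebra_simps)
qed

lemma artin_op_form:
  fixes X :: "'v::finite loq"
  assumes "X \<in> LOQ" "Suc k < CARD('v)"
  shows "artin_op k X = dec (artin_form k (enc X))"
proof -
  obtain Q \<tau> where X: "X = (Q, \<tau>)" "quiver Q" and lin: "\<tau> \<in> linear_orderings"
    using assms by (auto simp: LOQ_def)
  let ?n = "length \<tau>" and ?U = "companion X" and ?s = "transpose k (Suc k)"
  let ?G = "braid_matrix k ?U"
  obtain f where f: "enc X = (f, \<tau>)" by (simp add: X enc_def)
  have k: "Suc k < ?n" using assms lin by (simp add: length_linear_ordering)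
  have fU: "?U $$ (position \<tau> v, position \<tau> w) = f v w" for v w
    using companion_position[of Q \<tau> v w] assms f by (simp add: X)
  have p: "position \<tau> v = i \<longleftrightarrow> v = \<tau> ! i" if "i < ?n" for v i
    using that position(2)[OF lin] position_nth[OF lin] by metis
  have pk: "position \<tau> (\<tau> ! k) = k" "position \<tau> (\<tau> ! Suc k) = Suc k"
    using k by (auto intro: position_nth[OF lin])
  have U: "?U \<in> carrier_mat ?n ?n" by (simp add: X companion_def)
  have pos_lt: "?s (position \<tau> v) < ?n" for v
    using k position(1)[OF lin, of v] by (auto simp: transpose_def)
  have "(?G * ?U * transpose_mat ?G) $$ (?s (position \<tau> v), ?s (position \<tau> w)) =
     transvect (f (\<tau> ! k) (\<tau> ! Suc k)) (\<tau> ! k) (\<tau> ! Suc k) f v w" for v w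
    using k
    by (subst braid_matrix_congruence[OF U k pos_lt pos_lt])
      (simp add: transvect_def p flip: fU, simp add: pk)
  thus ?thesis
    using f by (simp add: artin_op_def X Let_def loq_of_dec artin_form_def
        position_switch[OF lin k] fun_eq_iff)
qed

lemma sign_op_form:
  fixes X :: "'v::finite loq"
  assumes "X \<in> LOQ"
  shows "sign_op i X = dec (sign_form i (enc X))"
proof -
  obtain Q \<tau> where X: "X = (Q, \<tau>)" "quiver Q" and lin: "\<tau> \<in> linear_orderings"
    using assms by (auto simp: LOQ_def)
  have "fst (sign_op i X) v w = fst (dec (sign_form i (enc X))) v w" for v w
  proof -
    have "Q v v = 0" "Q v w = 0 \<or> Q w v = 0" using X(2) by (auto simp: quiver_def)
    thus ?thesis
      by (cases rule: position_less_cases[OF lin, of v w])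
        (auto simp: X(1) dec_def enc_def sign_form_def sign_op_def signed_arrows_def reverse_at_def)
  qed
  thus ?thesis by (auto simp: X sign_op_def sign_form_def dec_def enc_def)
qed

lemma unitri_transvect:
  assumes "unitri (f, \<tau>)" "Suc k < length \<tau>" "{x, y} = {\<tau> ! k, \<tau> ! Suc k}" "x \<noteq> y"
    and c: "c = f x y + f y x"
  shows "unitri (transvect c x y f, switch k \<tau>)"
proof -
  have lin: "\<tau> \<in> linear_orderings" using assms(1) by (simp add: unitri_def)
  have pk: "position \<tau> (\<tau> ! k) = k" "position \<tau> (\<tau> ! Suc k) = Suc k"
    using assms(2) by (auto intro: position_nth[OF lin])
  have p: "position \<tau> v = k \<longleftrightarrow> v = \<tau> ! k" "position \<tau> v = Suc k \<longleftrightarrow> v = \<tau> ! Suc k" for v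
    using pk position_eq_iff[OF lin] by metis+
  have d: "f v v = 1" for v using assms(1) by (simp add: unitri_def)
  have z: "f v w = 0" if "position \<tau> w < position \<tau> v" for v w
    using assms(1) that by (simp add: unitri_def)
  have xy: "f x y = 0 \<or> f y x = 0" using assms(3) pk z by (metis doubleton_eq_iff lessI)
  have "transvect c x y f v v = 1" for v
    using xy by (auto simp: transvect_def c d algebra_simps)
  moreover have "transvect c x y f v w = 0"
    if tr: "transpose k (Suc k) (position \<tau> w) < transpose k (Suc k) (position \<tau> v)" for v w
  proof -
    have vw: "v \<noteq> w" using tr by auto
    have "position \<tau> w < position \<tau> v \<or> w = \<tau> ! Suc k \<and> v = \<tau> ! k"
      using tr p[of v] p[of w] pk by (auto simp: transpose_def split: if_splits)
    thus ?thesis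
    proof
      assume lt: "position \<tau> w < position \<tau> v"
      have "position \<tau> w < k" if "v = \<tau> ! k \<or> v = \<tau> ! Suc k"
        using that lt tr pk p[of w] by (auto simp: transpose_def split: if_splits)
      moreover have pw: "position \<tau> v > Suc k" if "w = \<tau> ! k \<or> w = \<tau> ! Suc k"
        using that lt tr pk p[of v] by (auto simp: transpose_def split: if_splits)
      moreover have px: "position \<tau> x \<in> {k, Suc k}" "position \<tau> y \<in> {k, Suc k}"
        "y = \<tau> ! k \<or> y = \<tau> ! Suc k"
        using assms(3) p by (auto simp: doubleton_eq_iff)
      ultimately have "f x w = 0" if "v = y" using that by (auto intro!: z)
      moreover have "f v x = 0" if "w = y"
        using that pw px by (intro z) auto
      ultimately show ?thesis using vw lt z by (auto simp: transvect_def)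
    next
      assume *: "w = \<tau> ! Suc k \<and> v = \<tau> ! k"
      hence "v = x \<and> w = y \<or> v = y \<and> w = x" using assms(3) by (auto simp: doubleton_eq_iff)
      moreover have "f w v = 0" using * pk by (intro z) simp
      ultimately show ?thesis using assms(4) by (auto simp: transvect_def c d)
    qed
  qed
  ultimately show ?thesis
    using switch_linear[OF lin assms(2)] by (simp add: unitri_def position_switch[OF lin assms(2)])
qed

lemma switch_switch: "Suc k < length \<tau> \<Longrightarrow> switch k (switch k \<tau>) = \<tau>"
  by (auto simp: switch_def nth_list_update intro!: nth_equalityI)

lemma
  assumes "unitri (f, \<tau> :: 'v::finite list)"
  shows unitri_linear: "\<tau> \<in> linear_orderings"
    and unitri_length: "length \<tau> = CARD('v)"
    and unitri_diag: "f v v = 1"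
    and unitri_nth: "i < j \<Longrightarrow> j < CARD('v) \<Longrightarrow> f (\<tau> ! j) (\<tau> ! i) = 0"
    and unitri_nth_eq: "i < CARD('v) \<Longrightarrow> j < CARD('v) \<Longrightarrow> \<tau> ! i = \<tau> ! j \<longleftrightarrow> i = j"
  using assms position_nth[of \<tau>] length_linear_ordering[of \<tau>]
  by (auto simp: unitri_def linear_orderings_iff nth_eq_iff_index_eq)

lemma unitri_artin_form:
  fixes Y :: "'v::finite form \<times> 'v list"
  assumes "unitri Y" "Suc k < CARD('v)"
  shows "unitri (artin_form k Y)" "unitri (artin_form_inv k Y)"
proof -
  obtain f \<tau> where Y: "Y = (f, \<tau>)" by (cases Y)
  note u = assms(1)[unfolded Y]
  have "f (\<tau> ! Suc k) (\<tau> ! k) = 0" "\<tau> ! k \<noteq> \<tau> ! Suc k" "Suc k < length \<tau>"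
    using unitri_nth[OF u, of k "Suc k"] unitri_nth_eq[OF u, of k "Suc k"] unitri_length[OF u] assms(2)
    by auto
  thus "unitri (artin_form k Y)" "unitri (artin_form_inv k Y)"
    by (auto simp: Y artin_form_def artin_form_inv_def Let_def intro!: unitri_transvect[OF u])
qed

lemma unitri_sign_form: "unitri Y \<Longrightarrow> unitri (sign_form i Y)"
  by (auto simp: unitri_def sign_form_def)

lemma transvect_inverse: "x \<noteq> y \<Longrightarrow> transvect (- c) x y (transvect c x y f) = f"
  by (auto simp: transvect_def fun_eq_iff algebra_simps)

lemma artin_form_inverse:
  fixes Y :: "'v::finite form \<times> 'v list"
  assumes "unitri Y" "Suc k < CARD('v)"
  shows "artin_form_inv k (artin_form k Y) = Y" "artin_form k (artin_form_inv k Y) = Y"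
proof -
  obtain f \<tau> where Y: "Y = (f, \<tau>)" by (cases Y)
  note u = assms(1)[unfolded Y]
  have z: "f (\<tau> ! Suc k) (\<tau> ! k) = 0" "\<tau> ! k \<noteq> \<tau> ! Suc k" and k: "Suc k < length \<tau>"
    using unitri_nth[OF u, of k "Suc k"] unitri_nth_eq[OF u, of k "Suc k"] unitri_length[OF u] assms(2)
    by auto
  have s: "switch k \<tau> ! k = \<tau> ! Suc k" "switch k \<tau> ! Suc k = \<tau> ! k"
    using k by (auto simp: switch_def)
  have t: "f y x = 0 \<Longrightarrow> transvect (f x y) x y f y x = - f x y"
    "f x y = 0 \<Longrightarrow> transvect (f y x) x y f x y = - f y x" if "x \<noteq> y" for x y
    using that by (auto simp: transvect_def unitri_diag[OF u])
  show "artin_form_inv k (artin_form k Y) = Y" "artin_form k (artin_form_inv k Y) = Y"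
    using z t[of "\<tau> ! k" "\<tau> ! Suc k"] t[of "\<tau> ! Suc k" "\<tau> ! k"]
    by (simp_all add: Y artin_form_def artin_form_inv_def Let_def s switch_switch[OF k] transvect_inverse)
qed

lemma sign_form_square: "sign_form i (sign_form i Y) = Y"
  by (cases Y) (auto simp: sign_form_def fun_eq_iff)

lemma sign_form_comm: "sign_form i (sign_form j Y) = sign_form j (sign_form i Y)"
  by (cases Y) (auto simp: sign_form_def fun_eq_iff)

lemma sign_artin_form:
  fixes Y :: "'v::finite form \<times> 'v list"
  assumes "unitri Y" "Suc k < CARD('v)" "i < CARD('v)"
  shows "sign_form i (artin_form k Y) = artin_form k (sign_form (transpose k (Suc k) i) Y)"
proof -
  obtain f \<tau> where Y: "Y = (f, \<tau>)" by (cases Y)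
  note u = assms(1)[unfolded Y]
  have ne: "\<tau> ! k \<noteq> \<tau> ! Suc k" and k: "Suc k < length \<tau>" "i < length \<tau>"
    using unitri_nth_eq[OF u, of k "Suc k"] unitri_length[OF u] assms(2,3) by auto
  show ?thesis
    using ne unfolding Y artin_form_def sign_form_def Let_def
    by (auto simp: nth_switch[OF k] transvect_def fun_eq_iff)
qed

lemma artin_form_far:
  fixes Y :: "'v::finite form \<times> 'v list"
  assumes "unitri Y" "Suc i < j" "Suc j < CARD('v)"
  shows "artin_form i (artin_form j Y) = artin_form j (artin_form i Y)"
proof -
  obtain f \<tau> where Y: "Y = (f, \<tau>)" by (cases Y)
  note u = assms(1)[unfolded Y]
  define x y z w where d: "x = \<tau> ! i" "y = \<tau> ! Suc i" "z = \<tau> ! j" "w = \<tau> ! Suc j"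
  have ne: "x \<noteq> y" "x \<noteq> z" "x \<noteq> w" "y \<noteq> z" "y \<noteq> w" "z \<noteq> w"
    using assms(2,3) by (auto simp: d unitri_nth_eq[OF u])
  have l: "length \<tau> = CARD('v)" by (rule unitri_length[OF u])
  have s: "switch i \<tau> ! j = z" "switch i \<tau> ! Suc j = w"
    "switch j \<tau> ! i = x" "switch j \<tau> ! Suc i = y"
    "switch i (switch j \<tau>) = switch j (switch i \<tau>)"
    using assms(2,3) l by (auto simp: d switch_def nth_list_update list_update_swap)
  have "transvect (transvect (f z w) z w f x y) x y (transvect (f z w) z w f) =
    transvect (transvect (f x y) x y f z w) z w (transvect (f x y) x y f)"
    using ne by (auto simp: transvect_def fun_eq_iff algebra_simps)
  thus ?thesis
    by (simp add: Y artin_form_def Let_def s flip: d)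
qed

lemma artin_form_braid:
  fixes Y :: "'v::finite form \<times> 'v list"
  assumes "unitri Y" "Suc (Suc i) < CARD('v)"
  shows "artin_form i (artin_form (Suc i) (artin_form i Y)) =
    artin_form (Suc i) (artin_form i (artin_form (Suc i) Y))"
proof -
  obtain f \<tau> where Y: "Y = (f, \<tau>)" by (cases Y)
  note u = assms(1)[unfolded Y]
  define x y z where d: "x = \<tau> ! i" "y = \<tau> ! Suc i" "z = \<tau> ! Suc (Suc i)"
  have ne: "x \<noteq> y" "x \<noteq> z" "y \<noteq> z"
    using assms(2) by (auto simp: d unitri_nth_eq[OF u])
  have f: "f x x = 1" "f y y = 1" "f z z = 1" "f y x = 0" "f z x = 0" "f z y = 0"
    using assms(2) by (auto simp: d unitri_diag[OF u] intro!: unitri_nth[OF u])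
  have l: "length \<tau> = CARD('v)" by (rule unitri_length[OF u])
  let ?l = "\<lambda>a b c. \<tau>[i := a, Suc i := b, Suc (Suc i) := c]"
  have sw: "switch i (?l a b c) = ?l b a c" "switch (Suc i) (?l a b c) = ?l a c b" for a b c
    using assms(2) l by (auto simp: switch_def nth_list_update intro!: nth_equalityI)
  have nth: "?l a b c ! i = a" "?l a b c ! Suc i = b" "?l a b c ! Suc (Suc i) = c" for a b c
    using assms(2) l by auto
  have \<tau>: "\<tau> = ?l x y z" by (simp add: d)
  have T: "artin_form i (g, ?l a b c) = (transvect (g a b) a b g, ?l b a c)"
    "artin_form (Suc i) (g, ?l a b c) = (transvect (g b c) b c g, ?l a c b)" for g a b c
    by (simp_all add: artin_form_def Let_def sw nth)
  let ?T = "\<lambda>a b g. transvect (g a b) a b g"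
  have "?T y z (?T x z (?T x y f)) = ?T x y (?T x z (?T y z f))"
    using ne f by (auto simp: transvect_def fun_eq_iff algebra_simps)
  thus ?thesis
    unfolding Y by (subst (1 2) \<tau>) (simp only: T)
qed

lemma
  fixes X :: "'v::finite loq"
  assumes "X \<in> LOQ" "g \<in> sbgens CARD('v)"
  shows gen_op_LOQ: "gen_op g X \<in> LOQ"
    and enc_gen_op: "enc (gen_op g X) = (case g of Artin k \<Rightarrow> artin_form k | Sign i \<Rightarrow> sign_form i) (enc X)"
  using assms unitri_enc[OF assms(1)]
  by (auto simp: sbgens_def artin_op_form sign_op_form dec_LOQ enc_dec
      unitri_artin_form unitri_sign_form split: sbgen.splits)

lemma inj_on_enc: "inj_on enc LOQ"
  by (metis dec_enc inj_on_inverseI)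

lemma gen_bij_Bij:
  assumes g: "g \<in> sbgens CARD('v::finite)"
  shows "(gen_bij g :: 'v loq \<Rightarrow> 'v loq) \<in> Bij LOQ"
proof -
  define h :: "'v form \<times> 'v list \<Rightarrow> 'v form \<times> 'v list"
    where "h = (case g of Artin k \<Rightarrow> artin_form_inv k | Sign i \<Rightarrow> sign_form i)"
  define e :: "'v form \<times> 'v list \<Rightarrow> 'v form \<times> 'v list"
    where "e = (case g of Artin k \<Rightarrow> artin_form k | Sign i \<Rightarrow> sign_form i)"
  have h: "unitri (h Y)" "h (e Y) = Y" "e (h Y) = Y" if "unitri Y" for Y
    using that g by (auto simp: h_def e_def sbgens_def unitri_artin_form unitri_sign_form
        artin_form_inverse sign_form_square)
  have eg: "enc (gen_op g X) = e (enc X)" if "X \<in> LOQ" for X :: "'v loq"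
    using enc_gen_op[OF that g] by (simp add: e_def)
  have "bij_betw (gen_op g) LOQ (LOQ :: 'v loq set)"
  proof (rule bij_betw_byWitness[where f' = "\<lambda>X. dec (h (enc X))"])
    show "\<forall>X\<in>LOQ. dec (h (enc (gen_op g X))) = (X :: 'v loq)"
      by (simp add: eg h unitri_enc dec_enc)
    show "\<forall>X\<in>LOQ. gen_op g (dec (h (enc X))) = (X :: 'v loq)"
    proof
      fix X :: "'v loq" assume X: "X \<in> LOQ"
      have "enc (gen_op g (dec (h (enc X)))) = enc X"
        using X by (simp add: eg h unitri_enc dec_LOQ enc_dec)
      thus "gen_op g (dec (h (enc X))) = X"
        using X g by (meson dec_LOQ gen_op_LOQ h(1) inj_onD inj_on_enc unitri_enc)
    qed
  qed (auto simp: gen_op_LOQ[OF _ g] h unitri_enc dec_LOQ)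
  thus ?thesis
    by (simp add: gen_bij_def Bij_def bij_betw_cong[of LOQ "restrict (gen_op g) LOQ" "gen_op g"])
qed

section \<open>The group and its action are well defined\<close>

lemma sbwords_append [simp]: "v @ w \<in> sbwords n \<longleftrightarrow> v \<in> sbwords n \<and> w \<in> sbwords n"
  by (auto simp: sbwords_def)

lemma sbwords_Nil [simp]: "[] \<in> sbwords n"
  by (simp add: sbwords_def)

lemma relator_sbwords:
  assumes "relator n v w"
  shows "v \<in> sbwords n" "w \<in> sbwords n"
  using assms by (cases, auto simp: sbwords_def sbgens_def)+

lemma sbcong_sbwords: "sbcong n v w \<Longrightarrow> v \<in> sbwords n \<longleftrightarrow> w \<in> sbwords n"
  by (induction rule: sbcong.induct) (auto simp: relator_sbwords)

lemma sbcong_append: "sbcong n v w \<Longrightarrow> sbcong n (x @ v @ y) (x @ w @ y)"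
proof (induction rule: sbcong.induct)
  case (rel v w x' y')
  thus ?case using sbcong.rel[of n v w "x @ x'" "y' @ y"] by simp
next
  case (refl v)
  show ?case by (rule sbcong.refl)
next
  case (sym v w)
  thus ?case by (meson sbcong.sym)
next
  case (trans u v w)
  thus ?case by (meson sbcong.trans)
qed

lemma sbcong_append2: "sbcong n v v' \<Longrightarrow> sbcong n w w' \<Longrightarrow> sbcong n (v @ w) (v' @ w')"
  using sbcong_append[of n v v' "[]" w] sbcong_append[of n w w' v' "[]"]
  by (simp add: sbcong.trans[of n "v @ w" "v' @ w"])

lemma equiv_sbeq: "equiv (sbwords n) (sbeq n)"
proof (rule equivI)
  show "sym (sbeq n)" by (auto simp: sbeq_def sym_def dest: sbcong.sym)
  show "trans (sbeq n)" unfolding sbeq_def trans_def by (blast dest: sbcong.trans)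
qed (auto simp: sbeq_def refl_on_def sbcong.refl)

lemma sbeq_class_mult:
  assumes "v \<in> sbwords n" "w \<in> sbwords n"
  shows "(sbeq n `` {v}) \<otimes>\<^bsub>signed_braid_group n\<^esub> (sbeq n `` {w}) = sbeq n `` {v @ w}"
proof -
  have "(\<lambda>v w. sbeq n `` {v @ w}) respects2 sbeq n"
  proof (rule congruent2I')
    fix v v' w w' assume "(v, v') \<in> sbeq n" "(w, w') \<in> sbeq n"
    hence "(v @ w, v' @ w') \<in> sbeq n" by (simp add: sbeq_def sbcong_append2)
    thus "sbeq n `` {v @ w} = sbeq n `` {v' @ w'}" by (rule equiv_class_eq[OF equiv_sbeq])
  qed
  from UN_equiv_class2[OF equiv_sbeq equiv_sbeq this assms]
  show ?thesis by (simp add: signed_braid_group_def)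
qed

lemma sbword_inverse:
  assumes "w \<in> sbwords n"
  shows "\<exists>v \<in> sbwords n. sbcong n (v @ w) []"
  using assms
proof (induction w)
  case Nil
  thus ?case by (auto intro: sbcong.refl)
next
  case (Cons l w)
  obtain g b where l: "l = (g, b)" by (cases l)
  from Cons obtain v where v: "v \<in> sbwords n" "sbcong n (v @ w) []"
    by (auto simp: sbwords_def)
  have g: "g \<in> sbgens n" using Cons.prems by (simp add: sbwords_def l)
  have "sbcong n (v @ [(g, \<not> b), l] @ w) (v @ [] @ w)"
    unfolding l using relator.cancel[OF g, of "\<not> b"] by (intro sbcong.rel) simp
  hence "sbcong n ((v @ [(g, \<not> b)]) @ l # w) []"
    using v(2) sbcong.trans by fastforce
  moreover have "v @ [(g, \<not> b)] \<in> sbwords n"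
    using v g by (simp add: sbwords_def)
  ultimately show ?case by blast
qed

lemma carrier_signed_braid_group:
  "carrier (signed_braid_group n) = (\<lambda>w. sbeq n `` {w}) ` sbwords n"
  by (auto simp: signed_braid_group_def quotient_def)

lemma one_signed_braid_group: "\<one>\<^bsub>signed_braid_group n\<^esub> = sbeq n `` {[]}"
  by (simp add: signed_braid_group_def)

lemma group_signed_braid_group: "group (signed_braid_group n)"
proof (rule groupI)
  fix A assume "A \<in> carrier (signed_braid_group n)"
  then obtain w where w: "w \<in> sbwords n" "A = sbeq n `` {w}"
    by (auto simp: carrier_signed_braid_group)
  obtain v where v: "v \<in> sbwords n" "sbcong n (v @ w) []"
    using sbword_inverse[OF w(1)] by blast
  have "sbeq n `` {v @ w} = sbeq n `` {[]}"
    using v w by (intro equiv_class_eq[OF equiv_sbeq]) (simp add: sbeq_def)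
  thus "\<exists>B\<in>carrier (signed_braid_group n). B \<otimes>\<^bsub>signed_braid_group n\<^esub> A = \<one>\<^bsub>signed_braid_group n\<^esub>"
    using v w by (auto simp: carrier_signed_braid_group sbeq_class_mult one_signed_braid_group)
qed (auto simp: carrier_signed_braid_group sbeq_class_mult one_signed_braid_group)

lemma letter_bij_Bij:
  assumes "fst l \<in> sbgens CARD('v::finite)"
  shows "(letter_bij l :: 'v loq \<Rightarrow> 'v loq) \<in> carrier (BijGroup LOQ)"
proof -
  have "(gen_bij (fst l) :: 'v loq \<Rightarrow> 'v loq) \<in> carrier (BijGroup LOQ)"
    using gen_bij_Bij[OF assms] by (simp add: BijGroup_def)
  thus ?thesis
    using group.inv_closed[OF group_BijGroup] by (auto simp: letter_bij_def split: prod.split)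
qed

lemma word_bij_Nil: "word_bij [] = \<one>\<^bsub>BijGroup LOQ\<^esub>"
  and word_bij_Cons: "word_bij (l # w) = letter_bij l \<otimes>\<^bsub>BijGroup LOQ\<^esub> word_bij w"
  by (simp_all add: word_bij_def)

lemma word_bij_Bij:
  "w \<in> sbwords CARD('v) \<Longrightarrow> (word_bij w :: 'v::finite loq \<Rightarrow> 'v loq) \<in> carrier (BijGroup LOQ)"
proof (induction w)
  case Nil
  interpret B: group "BijGroup (LOQ :: 'v loq set)" by (rule group_BijGroup)
  show ?case
    using B.one_closed by (simp add: word_bij_Nil)
next
  case (Cons l w)
  interpret B: group "BijGroup (LOQ :: 'v loq set)" by (rule group_BijGroup)
  from Cons.prems have "fst l \<in> sbgens CARD('v)" "w \<in> sbwords CARD('v)" by (auto simp: sbwords_def)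
  with Cons.IH show ?case
    using B.m_closed letter_bij_Bij[where 'v = 'v] by (simp add: word_bij_Cons)
qed

lemma word_bij_append:
  assumes "w \<in> sbwords CARD('v)"
  shows "v \<in> sbwords CARD('v) \<Longrightarrow>
    (word_bij (v @ w) :: 'v::finite loq \<Rightarrow> 'v loq) = word_bij v \<otimes>\<^bsub>BijGroup LOQ\<^esub> word_bij w"
proof (induction v)
  case Nil
  interpret B: group "BijGroup (LOQ :: 'v loq set)" by (rule group_BijGroup)
  show ?case
    using B.l_one[OF word_bij_Bij[OF assms]] by (simp add: word_bij_Nil)
next
  case (Cons l v)
  interpret B: group "BijGroup (LOQ :: 'v loq set)" by (rule group_BijGroup)
  from Cons.prems have "fst l \<in> sbgens CARD('v)" "v \<in> sbwords CARD('v)" by (auto simp: sbwords_def)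
  with Cons.IH show ?case
    using B.m_assoc[OF letter_bij_Bij word_bij_Bij word_bij_Bij] assms by (simp add: word_bij_Cons)
qed

lemma BijGroup_mult: "g \<in> Bij S \<Longrightarrow> f \<in> Bij S \<Longrightarrow> g \<otimes>\<^bsub>BijGroup S\<^esub> f = compose S g f"
  by (simp add: BijGroup_def)

lemma word_bij_generators:
  assumes "set gs \<subseteq> sbgens CARD('v::finite)"
  shows "word_bij (map (\<lambda>g. (g, True)) gs) = restrict (foldr gen_op gs) (LOQ :: 'v loq set)"
  using assms
proof (induction gs)
  case Nil
  show ?case by (simp add: word_bij_Nil BijGroup_def)
next
  case (Cons g gs)
  have "map (\<lambda>g. (g, True)) gs \<in> sbwords CARD('v)"
    using Cons.prems by (auto simp: sbwords_def)
  from word_bij_Bij[OF this]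
  have r: "restrict (foldr gen_op gs) (LOQ :: 'v loq set) \<in> Bij LOQ"
    using Cons by (simp add: BijGroup_def del: restrict_apply)
  have L: "foldr gen_op gs X \<in> LOQ" if "X \<in> LOQ" for X :: "'v loq"
    using funcset_mem[OF Bij_imp_funcset[OF r] that] that by simp
  have "word_bij (map (\<lambda>g. (g, True)) (g # gs)) =
    compose LOQ (gen_bij g) (restrict (foldr gen_op gs) (LOQ :: 'v loq set))"
    using Cons gen_bij_Bij[of g, where 'v = 'v] r
    by (simp add: word_bij_Cons letter_bij_def BijGroup_mult del: restrict_apply)
  also have "\<dots> = restrict (foldr gen_op (g # gs)) LOQ"
    by (rule ext) (simp add: compose_def gen_bij_def L)
  finally show ?case .
qed

definition form_op :: "sbgen \<Rightarrow> 'v form \<times> 'v list \<Rightarrow> 'v form \<times> 'v list" where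
  "form_op g = (case g of Artin k \<Rightarrow> artin_form k | Sign i \<Rightarrow> sign_form i)"

lemma foldr_gen_op:
  fixes X :: "'v::finite loq"
  assumes "set gs \<subseteq> sbgens CARD('v)" "X \<in> LOQ"
  shows "foldr gen_op gs X \<in> LOQ" "enc (foldr gen_op gs X) = foldr form_op gs (enc X)"
  using assms by (induction gs) (auto simp: gen_op_LOQ enc_gen_op form_op_def)

lemma word_bij_eqI:
  assumes "set gs \<subseteq> sbgens CARD('v::finite)" "set hs \<subseteq> sbgens CARD('v)"
    and "\<And>Y :: 'v form \<times> 'v list. unitri Y \<Longrightarrow> foldr form_op gs Y = foldr form_op hs Y"
  shows "word_bij (map (\<lambda>g. (g, True)) gs) =
    (word_bij (map (\<lambda>g. (g, True)) hs) :: 'v loq \<Rightarrow> 'v loq)"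
proof -
  have "foldr gen_op gs X = foldr gen_op hs X" if "X \<in> LOQ" for X :: "'v loq"
    using foldr_gen_op[OF assms(1) that] foldr_gen_op[OF assms(2) that]
      assms(3)[OF unitri_enc[OF that]] inj_onD[OF inj_on_enc] by metis
  thus ?thesis
    by (simp add: word_bij_generators assms(1,2) restrict_def fun_eq_iff)
qed

lemma relator_word_bij:
  assumes "relator CARD('v::finite) v w"
  shows "word_bij v = (word_bij w :: 'v loq \<Rightarrow> 'v loq)"
  using assms
proof cases
  case (cancel g b)
  interpret B: group "BijGroup (LOQ :: 'v loq set)" by (rule group_BijGroup)
  have "(gen_bij g :: 'v loq \<Rightarrow> 'v loq) \<in> carrier (BijGroup LOQ)"
    using gen_bij_Bij[OF cancel(3)] by (simp add: BijGroup_def)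
  thus ?thesis
    unfolding cancel(1,2)
    by (cases b) (simp_all add: word_bij_Cons word_bij_Nil letter_bij_def)
next
  case (artin_far i j)
  have "word_bij (map (\<lambda>g. (g, True)) [Artin i, Artin j]) =
    (word_bij (map (\<lambda>g. (g, True)) [Artin j, Artin i]) :: 'v loq \<Rightarrow> 'v loq)"
    by (rule word_bij_eqI) (use artin_far in \<open>auto simp: sbgens_def form_op_def artin_form_far[of _ i j]\<close>)
  thus ?thesis by (simp add: artin_far(1,2))
next
  case (artin_braid i)
  have "word_bij (map (\<lambda>g. (g, True)) [Artin i, Artin (Suc i), Artin i]) =
    (word_bij (map (\<lambda>g. (g, True)) [Artin (Suc i), Artin i, Artin (Suc i)]) :: 'v loq \<Rightarrow> 'v loq)"
    by (rule word_bij_eqI) (use artin_braid in \<open>auto simp: sbgens_def form_op_def artin_form_braid\<close>)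
  thus ?thesis by (simp add: artin_braid(1,2))
next
  case (sign_square i)
  have "word_bij (map (\<lambda>g. (g, True)) [Sign i, Sign i]) =
    (word_bij (map (\<lambda>g. (g, True)) []) :: 'v loq \<Rightarrow> 'v loq)"
    by (rule word_bij_eqI) (use sign_square in \<open>auto simp: sbgens_def form_op_def sign_form_square\<close>)
  thus ?thesis by (simp add: sign_square(1,2))
next
  case (sign_comm i j)
  have "word_bij (map (\<lambda>g. (g, True)) [Sign i, Sign j]) =
    (word_bij (map (\<lambda>g. (g, True)) [Sign j, Sign i]) :: 'v loq \<Rightarrow> 'v loq)"
    by (rule word_bij_eqI) (use sign_comm in \<open>auto simp: sbgens_def form_op_def sign_form_comm[of i j]\<close>)
  thus ?thesis by (simp add: sign_comm(1,2))
next
  case (cross_far k j)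
  have "word_bij (map (\<lambda>g. (g, True)) [Sign k, Artin j]) =
    (word_bij (map (\<lambda>g. (g, True)) [Artin j, Sign k]) :: 'v loq \<Rightarrow> 'v loq)"
    by (rule word_bij_eqI) (use cross_far in \<open>auto simp: sbgens_def form_op_def sign_artin_form transpose_def\<close>)
  thus ?thesis by (simp add: cross_far(1,2))
next
  case (cross_fst j)
  have "word_bij (map (\<lambda>g. (g, True)) [Sign j, Artin j]) =
    (word_bij (map (\<lambda>g. (g, True)) [Artin j, Sign (Suc j)]) :: 'v loq \<Rightarrow> 'v loq)"
    by (rule word_bij_eqI) (use cross_fst in \<open>auto simp: sbgens_def form_op_def sign_artin_form\<close>)
  thus ?thesis by (simp add: cross_fst(1,2))
next
  case (cross_snd j)
  have "word_bij (map (\<lambda>g. (g, True)) [Sign (Suc j), Artin j]) =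
    (word_bij (map (\<lambda>g. (g, True)) [Artin j, Sign j]) :: 'v loq \<Rightarrow> 'v loq)"
    by (rule word_bij_eqI) (use cross_snd in \<open>auto simp: sbgens_def form_op_def sign_artin_form\<close>)
  thus ?thesis by (simp add: cross_snd(1,2))
qed

lemma sbcong_word_bij:
  "sbcong CARD('v::finite) v w \<Longrightarrow> v \<in> sbwords CARD('v) \<Longrightarrow>
   word_bij v = (word_bij w :: 'v loq \<Rightarrow> 'v loq)"
proof (induction rule: sbcong.induct)
  case (rel v w x y)
  thus ?case
    using relator_sbwords[OF rel.hyps] relator_word_bij[OF rel.hyps]
    by (simp add: word_bij_append)
qed (auto dest: sbcong_sbwords)

lemma sbeq_word_bij:
  "(v, w) \<in> sbeq CARD('v::finite) \<Longrightarrow> word_bij v = (word_bij w :: 'v loq \<Rightarrow> 'v loq)"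
  by (simp add: sbeq_def sbcong_word_bij)

lemma signed_braid_action_class:
  assumes "w \<in> sbwords CARD('v::finite)"
  shows "signed_braid_action (sbeq CARD('v) `` {w}) = (word_bij w :: 'v loq \<Rightarrow> 'v loq)"
proof -
  have "(w, w) \<in> sbeq CARD('v)" using assms by (simp add: sbeq_def sbcong.refl)
  have "(word_bij ` (sbeq CARD('v) `` {w}) :: ('v loq \<Rightarrow> 'v loq) set) = {word_bij w}"
  proof (intro equalityI subsetI)
    fix h :: "'v loq \<Rightarrow> 'v loq" assume "h \<in> word_bij ` (sbeq CARD('v) `` {w})"
    then obtain v where "(w, v) \<in> sbeq CARD('v)" "h = word_bij v" by blast
    thus "h \<in> {word_bij w :: 'v loq \<Rightarrow> 'v loq}" using sbeq_word_bij[where 'v = 'v, of w v] by simp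
  qed (use \<open>(w, w) \<in> sbeq CARD('v)\<close> in auto)
  thus ?thesis by (simp add: signed_braid_action_def)
qed

theorem signed_braid_group_action:
  "group_action (signed_braid_group CARD('v::finite)) (LOQ :: 'v loq set) signed_braid_action"
  unfolding group_action_def group_hom_def group_hom_axioms_def
proof (intro conjI)
  show "group (signed_braid_group CARD('v))" by (rule group_signed_braid_group)
  show "group (BijGroup (LOQ :: 'v loq set))" by (rule group_BijGroup)
  show "signed_braid_action \<in> hom (signed_braid_group CARD('v)) (BijGroup (LOQ :: 'v loq set))"
    by (rule homI) (auto simp: carrier_signed_braid_group sbeq_class_mult
        signed_braid_action_class word_bij_Bij word_bij_append)
qed

section \<open>The orbit of a cyclically ordered quiver is well defined\<close>

lemma loq_orbit_generators:
  fixes X :: "'v::finite loq"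
  assumes "set gs \<subseteq> sbgens CARD('v)" "X \<in> LOQ"
  shows "foldr gen_op gs X \<in> loq_orbit X"
proof -
  let ?w = "map (\<lambda>g. (g, True)) gs"
  have w: "?w \<in> sbwords CARD('v)" using assms(1) by (auto simp: sbwords_def)
  have "signed_braid_action (sbeq CARD('v) `` {?w}) X = foldr gen_op gs X"
    using assms by (simp add: signed_braid_action_class[OF w] word_bij_generators)
  moreover have "sbeq CARD('v) `` {?w} \<in> carrier (signed_braid_group CARD('v))"
    using w by (auto simp: carrier_signed_braid_group)
  ultimately show ?thesis unfolding loq_orbit_def orbit_def by force
qed

text \<open>\<open>reflect_all\<close> is the effect on a form of moving \<open>x\<close> past all the vertices in \<open>A\<close>.\<close>

definition reflect_all :: "'v \<Rightarrow> 'v set \<Rightarrow> 'v form \<Rightarrow> 'v form" where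
  "reflect_all x A f = (\<lambda>v w. f v w - (if v \<in> A then f x v * f x w else 0)
     - (if w \<in> A then f v x * f x w else 0) + (if v \<in> A \<and> w \<in> A then f x v * f x w else 0))"

lemma transvect_reflect_all:
  assumes "x \<notin> A" "y \<notin> A" "x \<noteq> y" "f x x = 1"
  shows "transvect (reflect_all x A f x y) x y (reflect_all x A f) = reflect_all x (insert y A) f"
proof -
  have "reflect_all x A f x y = f x y" using assms by (simp add: reflect_all_def)
  thus ?thesis
    using assms by (auto simp: transvect_def reflect_all_def fun_eq_iff algebra_simps)
qed

lemma artin_form_sweep:
  assumes "distinct (x # ys)" "f x x = 1" "m \<le> length ys"
  shows "foldr artin_form (rev [0..<m]) (f, x # ys) =
    (reflect_all x (set (take m ys)) f, take m ys @ x # drop m ys)"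
  using assms(3)
proof (induction m)
  case 0
  show ?case by (auto simp: reflect_all_def fun_eq_iff)
next
  case (Suc m)
  let ?\<tau> = "take m ys @ x # drop m ys" and ?y = "ys ! m"
  have m: "m < length ys" using Suc.prems by simp
  have d: "drop m ys = ?y # drop (Suc m) ys" using m by (rule Cons_nth_drop_Suc[symmetric])
  have t: "take (Suc m) ys = take m ys @ [?y]" using m by (rule take_Suc_conv_app_nth)
  have n: "?\<tau> ! m = x" "?\<tau> ! Suc m = ?y"
    using m by (simp_all add: nth_append min_def)
  have s: "switch m ?\<tau> = take (Suc m) ys @ x # drop (Suc m) ys"
    unfolding switch_def n using m by (simp add: list_update_append d t min_def)
  have "distinct (take m ys @ ?y # drop (Suc m) ys)"
    using assms(1) d by (metis append_take_drop_id distinct.simps(2))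
  hence y: "?y \<notin> set (take m ys)" by simp
  have x: "x \<notin> set (take m ys)" "x \<noteq> ?y"
    using assms(1) m by (auto dest: in_set_takeD)
  have "foldr artin_form (rev [0..<Suc m]) (f, x # ys) =
    artin_form m (reflect_all x (set (take m ys)) f, ?\<tau>)"
    using Suc.IH m by simp
  also have "\<dots> = (reflect_all x (insert ?y (set (take m ys))) f, take (Suc m) ys @ x # drop (Suc m) ys)"
    using transvect_reflect_all[of x "set (take m ys)" ?y f, OF x(1) y x(2) assms(2)] by (simp add: artin_form_def n s)
  finally show ?case by (simp add: t)
qed

lemma position_eqI: "\<tau> \<in> linear_orderings \<Longrightarrow> i < length \<tau> \<Longrightarrow> \<tau> ! i = v \<Longrightarrow> position \<tau> v = i"
  using position_nth by blast

lemma enc_rotate1: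
  assumes "(Q, x # ys) \<in> LOQ"
  shows "enc (Q, ys @ [x]) = (reflect_all x (set ys) (fst (enc (Q, x # ys))), ys @ [x])"
proof -
  have lin: "x # ys \<in> linear_orderings" using assms by (simp add: LOQ_def)
  hence lin': "ys @ [x] \<in> linear_orderings" by (auto simp: linear_orderings_def)
  have x: "x \<notin> set ys" using lin by (simp add: linear_orderings_def)
  have V: "v = x \<or> v \<in> set ys" for v using lin by (auto simp: linear_orderings_def)
  have px: "position (x # ys) x = 0" "position (ys @ [x]) x = length ys"
    by (auto intro: position_eqI[OF lin] position_eqI[OF lin'])
  have py: "position (x # ys) v = Suc (position (ys @ [x]) v) \<and> position (ys @ [x]) v < length ys"
    if v: "v \<in> set ys" for v
  proof -
    obtain i where i: "i < length ys" "ys ! i = v" using v by (metis in_set_conv_nth)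
    have "position (ys @ [x]) v = i" "position (x # ys) v = Suc i"
      using i by (auto intro: position_eqI[OF lin] position_eqI[OF lin'] simp: nth_append)
    thus ?thesis using i by simp
  qed
  have "fst (enc (Q, ys @ [x])) v w = reflect_all x (set ys) (fst (enc (Q, x # ys))) v w" for v w
    using V[of v] V[of w] x py[of v] py[of w]
    by (auto simp: enc_def reflect_all_def px signed_arrows_def)
  thus ?thesis by (auto simp: enc_def fun_eq_iff)
qed

lemma rotate1_LOQ: "(Q, \<tau>) \<in> LOQ \<Longrightarrow> (Q, rotate1 \<tau>) \<in> LOQ"
  by (simp add: LOQ_def linear_orderings_def)

lemma rotate1_loq_orbit:
  fixes \<tau> :: "'v::finite list"
  assumes "(Q, \<tau>) \<in> LOQ"
  shows "(Q, rotate1 \<tau>) \<in> loq_orbit (Q, \<tau>)"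
proof -
  have lin: "\<tau> \<in> linear_orderings" using assms by (simp add: LOQ_def)
  hence "\<tau> \<noteq> []" by (auto simp: linear_orderings_def)
  then obtain x ys where \<tau>: "\<tau> = x # ys" by (cases \<tau>) auto
  have len: "Suc (length ys) = CARD('v)" using length_linear_ordering[OF lin] by (simp add: \<tau>)
  let ?gs = "map Artin (rev [0..<length ys])"
  have gs: "set ?gs \<subseteq> sbgens CARD('v)" by (auto simp: sbgens_def simp flip: len)
  obtain f where f: "enc (Q, \<tau>) = (f, \<tau>)" by (simp add: enc_def)
  have fx: "f x x = 1" using unitri_enc[OF assms] by (simp add: f unitri_def)
  have d: "distinct (x # ys)" using lin by (simp add: \<tau> linear_orderings_def)
  have "foldr form_op ?gs (f, \<tau>) = foldr artin_form (rev [0..<length ys]) (f, \<tau>)"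
    unfolding foldr_map by (simp add: comp_def form_op_def)
  hence "enc (foldr gen_op ?gs (Q, \<tau>)) = (reflect_all x (set ys) f, ys @ [x])"
    using foldr_gen_op(2)[OF gs assms] artin_form_sweep[of x ys f "length ys", OF d fx] f
    by (simp add: \<tau>)
  also have "\<dots> = enc (Q, rotate1 \<tau>)"
    using enc_rotate1[of Q x ys] assms f by (simp add: \<tau>)
  finally have "foldr gen_op ?gs (Q, \<tau>) = (Q, rotate1 \<tau>)"
    using inj_onD[OF inj_on_enc] foldr_gen_op(1)[OF gs assms] rotate1_LOQ[OF assms] by blast
  thus ?thesis using loq_orbit_generators[OF gs assms] by simp
qed

lemma loq_orbit_refl: "X \<in> LOQ \<Longrightarrow> X \<in> loq_orbit X"
  unfolding loq_orbit_def by (rule group_action.orbit_refl[OF signed_braid_group_action])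

lemma loq_orbit_LOQ: "X \<in> LOQ \<Longrightarrow> Y \<in> loq_orbit X \<Longrightarrow> Y \<in> LOQ"
  unfolding loq_orbit_def orbit_def
  using group_action.element_image[OF signed_braid_group_action] by blast

lemma loq_orbit_sym: "X \<in> LOQ \<Longrightarrow> Y \<in> loq_orbit X \<Longrightarrow> X \<in> loq_orbit Y"
  using loq_orbit_LOQ[of X Y] group_action.orbit_sym[OF signed_braid_group_action, of X Y]
  by (simp add: loq_orbit_def)

lemma loq_orbit_trans: "X \<in> LOQ \<Longrightarrow> Y \<in> loq_orbit X \<Longrightarrow> Z \<in> loq_orbit Y \<Longrightarrow> Z \<in> loq_orbit X"
  using loq_orbit_LOQ[of X Y] loq_orbit_LOQ[of Y Z]
    group_action.orbit_trans[OF signed_braid_group_action, of X Y Z]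
  by (auto simp: loq_orbit_def)

lemma rotate_loq_orbit:
  fixes \<tau> :: "'v::finite list"
  assumes "(Q, \<tau>) \<in> LOQ"
  shows "(Q, rotate m \<tau>) \<in> LOQ \<and> (Q, rotate m \<tau>) \<in> loq_orbit (Q, \<tau>)"
proof (induction m)
  case 0
  show ?case using assms loq_orbit_refl by simp
next
  case (Suc m)
  thus ?case
    using rotate1_LOQ[of Q "rotate m \<tau>"] rotate1_loq_orbit[of Q "rotate m \<tau>"]
      loq_orbit_trans[OF assms, of "(Q, rotate m \<tau>)" "(Q, rotate1 (rotate m \<tau>))"]
    by (simp add: rotate_Suc)
qed

lemma cyclic_ordering_rotate:
  assumes "\<sigma> \<in> cyclic_orderings" "\<tau> \<in> \<sigma>" "\<tau>' \<in> \<sigma>"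
  shows "\<tau> \<in> linear_orderings" "\<exists>m. \<tau>' = rotate m \<tau>"
proof -
  obtain \<tau>0 a b where *: "\<tau>0 \<in> linear_orderings" "\<tau> = rotate a \<tau>0" "\<tau>' = rotate b \<tau>0"
    using assms by (auto simp: cyclic_orderings_def cyclic_class_def)
  thus "\<tau> \<in> linear_orderings" by (simp add: linear_orderings_def)
  let ?n = "length \<tau>0"
  have "rotate (b + (?n - a mod ?n)) \<tau> = rotate (b + (?n - a mod ?n) + a mod ?n) \<tau>0"
    using *(2) by (metis rotate_conv_mod rotate_rotate)
  also have "\<dots> = rotate (b + ?n) \<tau>0"
  proof (cases "?n = 0")
    case False
    hence "a mod ?n \<le> ?n" by (simp add: less_imp_le)
    thus ?thesis by simp
  qed simp
  also have "\<dots> = \<tau>'" using *(3) by (metis mod_add_self2 rotate_conv_mod)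
  finally show "\<exists>m. \<tau>' = rotate m \<tau>" by metis
qed

theorem coq_orbit_iff:
  fixes Q :: "'v::finite quiver"
  assumes "(Q, \<sigma>) \<in> COQ" "(Q', \<sigma>') \<in> COQ" "\<tau> \<in> \<sigma>" "\<tau>' \<in> \<sigma>'"
  shows "(Q', \<sigma>') \<in> coq_orbit (Q, \<sigma>) \<longleftrightarrow> (Q', \<tau>') \<in> loq_orbit (Q, \<tau>)"
proof
  assume "(Q', \<sigma>') \<in> coq_orbit (Q, \<sigma>)"
  then obtain \<rho> \<rho>' where \<rho>: "\<rho> \<in> \<sigma>" "\<rho>' \<in> \<sigma>'" "(Q', \<rho>') \<in> loq_orbit (Q, \<rho>)"
    by (auto simp: coq_orbit_def)
  have L: "(Q, \<tau>) \<in> LOQ" "(Q', \<rho>') \<in> LOQ"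
    using assms \<rho> cyclic_ordering_rotate(1) by (auto simp: COQ_def LOQ_def)
  have 1: "(Q, \<rho>) \<in> loq_orbit (Q, \<tau>)"
    using cyclic_ordering_rotate(2)[of \<sigma> \<tau> \<rho>] assms \<rho> rotate_loq_orbit[OF L(1)]
    by (auto simp: COQ_def)
  have 2: "(Q', \<tau>') \<in> loq_orbit (Q', \<rho>')"
    using cyclic_ordering_rotate(2)[of \<sigma>' \<rho>' \<tau>'] assms \<rho> rotate_loq_orbit[OF L(2)]
    by (auto simp: COQ_def)
  show "(Q', \<tau>') \<in> loq_orbit (Q, \<tau>)"
    using loq_orbit_trans[OF L(1)] 1 2 \<rho>(3) by blast
next
  assume "(Q', \<tau>') \<in> loq_orbit (Q, \<tau>)"
  thus "(Q', \<sigma>') \<in> coq_orbit (Q, \<sigma>)" using assms by (auto simp: coq_orbit_def)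
qed

end

theory Submission
  imports Defs
begin

text \<open>
  The signed adjacency matrix is the transpose of the companion minus the companion. It therefore
  transforms under \<open>\<sigma>\<^sub>k\<close> by the same change of basis as the companion, and the outcome no longer
  depends on where in the linear ordering the switch takes place.

  A proper mutation at \<open>j\<close> followed by the reversal at \<open>j\<close> is a product of Artin generators that
  moves \<open>j\<close> past the vertices in question one at a time, so every step stays in the orbit. Conversely,
  to realize a single generator, moving \<open>x\<close> past the next vertex \<open>y\<close>, one applies reversals at
  vertices other than \<open>x\<close> until \<open>y\<close> is the only vertex that can receive an arrow from \<open>x\<close>; then
  \<open>x\<close> is proper and may be moved past \<open>y\<close> alone, after which the reversals are undone.
  Inverse generators need no separate treatment because every step is reversible.
\<close>

section \<open>Signed arrows\<close>

lemma signed_arrows_self [simp]: "signed_arrows Q v v = 0"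
  by (simp add: signed_arrows_def)

lemma signed_arrows_swap: "signed_arrows Q w v = - signed_arrows Q v w"
  by (simp add: signed_arrows_def)

text \<open>Without 2-cycles, the multiplicity from \<open>v\<close> to \<open>w\<close> is the
  positive part of the signed count, so signed counts lose no information.\<close>

lemma quiver_eqI:
  assumes "quiver Q" "quiver Q'" "\<And>v w. signed_arrows Q v w = signed_arrows Q' v w"
  shows "Q = Q'"
proof -
  have "R = (\<lambda>v w. nat (signed_arrows R v w))" if "quiver R" for R :: "'a quiver"
  proof (intro ext)
    fix v w
    have "R v w = 0 \<or> R w v = 0" using that by (simp add: quiver_def)
    thus "R v w = nat (signed_arrows R v w)" by (auto simp: signed_arrows_def)
  qed
  from this[OF assms(1)] this[OF assms(2)] show ?thesis by (simp add: assms(3))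
qed

lemma quiver_reverse_at: "quiver Q \<Longrightarrow> quiver (reverse_at v Q)"
  by (auto simp: quiver_def reverse_at_def)

lemma reverse_at_reverse_at: "reverse_at v (reverse_at v Q) = Q"
  by (auto simp: reverse_at_def fun_eq_iff)

lemma signed_arrows_reverse_at:
  "signed_arrows (reverse_at j Q) v w = (if v = j \<or> w = j then - signed_arrows Q v w else signed_arrows Q v w)"
  by (auto simp: signed_arrows_def reverse_at_def)

section \<open>Mutation in terms of signed arrow counts\<close>

lemma quiver_mutation: "quiver (mutation j Q)"
  by (auto simp: quiver_def mutation_def cancel_2cycles_def)

text \<open>As \<open>j\<close> carries no loop, no composite arrow starts or ends at
  \<open>j\<close>, so only the reversal is seen there.\<close>

lemma mutation_at:
  assumes "quiver Q"
  shows "mutation j Q j v = Q v j" "mutation j Q v j = Q j v"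
proof -
  have "Q j j = 0" "Q j v = 0 \<or> Q v j = 0" using assms by (auto simp: quiver_def)
  thus "mutation j Q j v = Q v j" "mutation j Q v j = Q j v"
    by (auto simp: mutation_def cancel_2cycles_def reverse_at_def add_composite_arrows_def)
qed

text \<open>The two truncated differences in \<open>cancel_2cycles\<close> have the untruncated
  difference as their own difference. Removing 2-cycles is thus invisible to signed counts, and
  mutation becomes an integer formula.\<close>

lemma signed_arrows_mutation:
  assumes "quiver Q"
  shows "signed_arrows (mutation j Q) v w = (if v = j \<or> w = j then - signed_arrows Q v w
    else signed_arrows Q v w + int (Q v j * Q j w) - int (Q w j * Q j v))"
proof (cases "v = j \<or> w = j")
  case True
  thus ?thesis using mutation_at[OF assms] by (auto simp: signed_arrows_def)
next
  case False
  have "int (a - b) - int (b - a) = int a - int b" for a b :: nat by simp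
  with False show ?thesis
    by (simp add: signed_arrows_def mutation_def cancel_2cycles_def reverse_at_def
        add_composite_arrows_def)
qed

text \<open>The second mutation sees the multiplicities into and out of \<open>j\<close> exchanged,
  so its composite arrows cancel those of the first.\<close>

lemma mutation_mutation:
  assumes "quiver Q"
  shows "mutation j (mutation j Q) = Q"
  by (rule quiver_eqI[OF quiver_mutation assms])
    (simp add: signed_arrows_mutation[OF quiver_mutation] signed_arrows_mutation[OF assms]
      mutation_at[OF assms] mult.commute)

text \<open>The composite of the reversals at the vertices of \<open>S\<close>: an arrow with both
  ends in \<open>S\<close> is reversed twice and so kept. On signed counts this is conjugation by a
  diagonal sign matrix.\<close>

definition reverse_set :: "'v set \<Rightarrow> 'v quiver \<Rightarrow> 'v quiver" where
  "reverse_set S Q = (\<lambda>i k. if (i \<in> S) = (k \<in> S) then Q i k else Q k i)"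

lemma reverse_set_reverse_set: "reverse_set S (reverse_set S Q) = Q"
  by (auto simp: reverse_set_def fun_eq_iff)

lemma quiver_reverse_set: "quiver Q \<Longrightarrow> quiver (reverse_set S Q)"
  by (auto simp: quiver_def reverse_set_def)

lemma reverse_set_insert: "v \<notin> S \<Longrightarrow> reverse_set (insert v S) Q = reverse_at v (reverse_set S Q)"
  by (auto simp: reverse_set_def reverse_at_def fun_eq_iff)

lemma signed_arrows_reverse_set:
  "signed_arrows (reverse_set S Q) v w =
    (if v \<in> S then -1 else 1) * (if w \<in> S then -1 else 1) * signed_arrows Q v w"
  by (auto simp: signed_arrows_def reverse_set_def)

section \<open>Cyclic orderings\<close>

lemma self_in_cyclic_class: "\<tau> \<in> cyclic_class \<tau>"
  unfolding cyclic_class_def by (intro CollectI exI[of _ 0]) simp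

lemma cyclic_class_in_cyclic_orderings: "\<tau> \<in> linear_orderings \<Longrightarrow> cyclic_class \<tau> \<in> cyclic_orderings"
  by (simp add: cyclic_orderings_def)

lemma cyclic_ordering_eq_class:
  assumes "\<sigma> \<in> cyclic_orderings" "\<tau> \<in> \<sigma>"
  shows "\<sigma> = cyclic_class \<tau>"
proof (intro equalityI subsetI)
  fix \<tau>' assume "\<tau>' \<in> \<sigma>"
  thus "\<tau>' \<in> cyclic_class \<tau>"
    using cyclic_ordering_rotate(2)[OF assms] by (auto simp: cyclic_class_def)
next
  fix \<tau>' assume "\<tau>' \<in> cyclic_class \<tau>"
  then obtain m where m: "\<tau>' = rotate m \<tau>" by (auto simp: cyclic_class_def)
  obtain \<tau>0 where \<tau>0: "\<sigma> = cyclic_class \<tau>0" using assms(1) by (auto simp: cyclic_orderings_def)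
  then obtain a where "\<tau> = rotate a \<tau>0" using assms(2) by (auto simp: cyclic_class_def)
  thus "\<tau>' \<in> \<sigma>" unfolding \<tau>0 m cyclic_class_def by (auto simp: rotate_rotate)
qed

lemma cyclic_class_append_swap:
  assumes "xs @ ys \<in> linear_orderings"
  shows "cyclic_class (xs @ ys) = cyclic_class (ys @ xs)"
proof (rule cyclic_ordering_eq_class)
  show "cyclic_class (xs @ ys) \<in> cyclic_orderings"
    using assms by (rule cyclic_class_in_cyclic_orderings)
  show "ys @ xs \<in> cyclic_class (xs @ ys)"
    unfolding cyclic_class_def
    by (intro CollectI exI[of _ "length xs"]) (simp add: rotate_append)
qed

lemma COQ_linear: "(Q, \<sigma>) \<in> COQ \<Longrightarrow> \<tau> \<in> \<sigma> \<Longrightarrow> quiver Q \<and> \<tau> \<in> linear_orderings \<and> \<sigma> = cyclic_class \<tau>"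
  using cyclic_ordering_eq_class cyclic_ordering_rotate(1) by (auto simp: COQ_def)

lemma COQ_class: "(Q, cyclic_class \<tau>) \<in> COQ" if "(Q, \<tau>) \<in> LOQ"
  using that by (simp add: COQ_def LOQ_def cyclic_class_in_cyclic_orderings)

section \<open>Steps are reversible\<close>

text \<open>In-vertices of \<open>j\<close> lie in \<open>ys\<close> and out-vertices in
  \<open>xs\<close>. Cutting the circle open just before an in-vertex \<open>i\<close> makes
  \<open>j\<close> and then the out-vertex \<open>k\<close> follow it. Properness can thus be
  established by exhibiting such a split.\<close>

lemma proper_if_separated:
  assumes lin: "j # xs @ ys \<in> linear_orderings"
    and "quiver Q" "Out Q j \<subseteq> set xs" "In Q j \<inter> set xs = {}"
  shows "proper (Q, cyclic_class (j # xs @ ys)) j"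
  unfolding proper_def prod.case right_turn_def
proof (intro allI impI, elim conjE)
  fix i k assume ik: "arrow Q i j" "arrow Q j k"
  have "k \<in> set xs" using ik assms(3) by (auto simp: Out_def)
  then obtain a b where xs: "xs = a @ k # b" by (meson split_list)
  have "i \<noteq> j" using ik(1) assms(2) by (auto simp: quiver_def arrow_def)
  moreover have "i \<notin> set xs" using ik assms(4) by (auto simp: In_def)
  ultimately have "i \<in> set ys" using lin by (auto simp: linear_orderings_def)
  then obtain c d where ys: "ys = c @ i # d" by (meson split_list)
  have "cyclic_class ((j # xs @ c) @ (i # d)) = cyclic_class ((i # d) @ (j # xs @ c))"
    using lin by (intro cyclic_class_append_swap) (simp add: ys)
  hence "[] @ [i] @ d @ [j] @ a @ [k] @ (b @ c) \<in> cyclic_class (j # xs @ ys)"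
    using self_in_cyclic_class[of "(i # d) @ (j # xs @ c)"] by (simp add: xs ys)
  thus "\<exists>xs' ys' zs ws. xs' @ [i] @ ys' @ [j] @ zs @ [k] @ ws \<in> cyclic_class (j # xs @ ys)"
    by blast
qed

lemma proper_mutation_class:
  assumes "j # xs @ ys \<in> linear_orderings" "quiver Q" "Out Q j \<subseteq> set xs" "In Q j \<inter> set xs = {}"
  shows "proper_mutation j (Q, cyclic_class (j # xs @ ys)) (mutation j Q, cyclic_class (xs @ j # ys))"
  using proper_if_separated[OF assms] self_in_cyclic_class assms(3,4) by (rule proper_mutation.intros)

lemma coq_step_COQ:
  assumes "coq_step X Y" "X \<in> COQ"
  shows "Y \<in> COQ"
proof -
  obtain Q \<sigma> where X: "X = (Q, \<sigma>)" by (cases X)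
  note L = COQ_linear[OF assms(2)[unfolded X]]
  consider j where "proper_mutation j X Y" | "reversal X Y" | "wiggle X Y"
    using assms(1) by (auto simp: coq_step_def)
  thus ?thesis
  proof cases
    case 1
    then obtain xs ys where "j # xs @ ys \<in> \<sigma>" "Y = (mutation j Q, cyclic_class (xs @ j # ys))"
      unfolding X by (auto elim: proper_mutation.cases)
    thus ?thesis
      using L[of "j # xs @ ys"] by (auto intro!: COQ_class simp: LOQ_def quiver_mutation linear_orderings_def)
  next
    case 2
    thus ?thesis
      using assms(2) unfolding X by (auto elim!: reversal.cases simp: COQ_def quiver_reverse_at)
  next
    case 3
    then obtain a b ys where "a # b # ys \<in> \<sigma>" "Y = (Q, cyclic_class (b # a # ys))"
      unfolding X by (auto elim: wiggle.cases)
    thus ?thesis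
      using L[of "a # b # ys"] by (auto intro!: COQ_class simp: LOQ_def linear_orderings_def)
  qed
qed

text \<open>A proper mutation is undone by another one at \<open>j\<close>, not by moving
  \<open>j\<close> back: after moving past \<open>xs\<close>, moving on clockwise past
  \<open>ys\<close> completes the circle.\<close>

lemma coq_step_sym:
  assumes "coq_step X Y" "X \<in> COQ"
  shows "coq_step Y X"
proof -
  obtain Q \<sigma> where X: "X = (Q, \<sigma>)" by (cases X)
  note L = COQ_linear[OF assms(2)[unfolded X]]
  consider j where "proper_mutation j X Y" | "reversal X Y" | "wiggle X Y"
    using assms(1) by (auto simp: coq_step_def)
  thus ?thesis
  proof cases
    case 1
    then obtain xs ys where *: "j # xs @ ys \<in> \<sigma>" "Out Q j \<subseteq> set xs" "In Q j \<inter> set xs = {}"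
      and Y: "Y = (mutation j Q, cyclic_class (xs @ j # ys))"
      unfolding X by (auto elim: proper_mutation.cases)
    have q: "quiver Q" and lin: "j # xs @ ys \<in> linear_orderings"
      and \<sigma>: "\<sigma> = cyclic_class (j # xs @ ys)" using L[OF *(1)] by auto
    have lin': "j # ys @ xs \<in> linear_orderings" using lin by (auto simp: linear_orderings_def)
    have I: "In (mutation j Q) j = Out Q j" "Out (mutation j Q) j = In Q j"
      by (auto simp: In_def Out_def arrow_def mutation_at[OF q])
    \<comment> \<open>Mutation exchanges \<open>In\<close> and \<open>Out\<close> at
      \<open>j\<close>, so the reverse step needs the old in-vertices inside \<open>ys\<close> and
      the old out-vertices outside it.\<close>
    have "In Q j \<subseteq> set ys"
    proof
      fix i assume i: "i \<in> In Q j"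
      hence "i \<noteq> j" using q by (auto simp: In_def arrow_def quiver_def)
      thus "i \<in> set ys" using i *(3) lin by (auto simp: linear_orderings_def)
    qed
    moreover have "Out Q j \<inter> set ys = {}" using *(2) lin by (auto simp: linear_orderings_def)
    ultimately have "proper_mutation j (mutation j Q, cyclic_class (j # ys @ xs)) (Q, cyclic_class (ys @ j # xs))"
      using proper_mutation_class[OF lin' quiver_mutation[of j Q]] by (simp add: I mutation_mutation[OF q])
    moreover have "cyclic_class (ys @ j # xs) = \<sigma>"
      unfolding \<sigma> using cyclic_class_append_swap[of "j # xs" ys] lin by simp
    moreover have "cyclic_class (j # ys @ xs) = cyclic_class (xs @ j # ys)"
      using cyclic_class_append_swap[of "j # ys" xs] lin' by simp
    ultimately show ?thesis unfolding coq_step_def X Y by auto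
  next
    case 2
    then obtain v where Y: "Y = (reverse_at v Q, \<sigma>)" unfolding X by (auto elim: reversal.cases)
    thus ?thesis
      using reversal.intros[of "reverse_at v Q" \<sigma> v] by (simp add: X coq_step_def reverse_at_reverse_at)
  next
    case 3
    then obtain a b ys where *: "a # b # ys \<in> \<sigma>" "\<not> adjacent Q a b" and Y: "Y = (Q, cyclic_class (b # a # ys))"
      unfolding X by (auto elim: wiggle.cases)
    have "\<not> adjacent Q b a" using *(2) by (auto simp: adjacent_def)
    from wiggle.intros[OF self_in_cyclic_class this, of ys]
    show ?thesis using L[OF *(1)] by (simp add: X Y coq_step_def)
  qed
qed

lemma coq_steps_COQ: "coq_step\<^sup>*\<^sup>* X Y \<Longrightarrow> X \<in> COQ \<Longrightarrow> Y \<in> COQ"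
  by (induction rule: rtranclp_induct) (auto intro: coq_step_COQ)

lemma coq_steps_sym:
  assumes "coq_step\<^sup>*\<^sup>* X Y" "X \<in> COQ"
  shows "coq_step\<^sup>*\<^sup>* Y X"
  using assms(1)
proof (induction rule: rtranclp_induct)
  case (step Y Z)
  hence "coq_step Z Y" using coq_step_sym coq_steps_COQ assms(2) by blast
  thus ?case using step.IH by (rule converse_rtranclp_into_rtranclp)
qed simp

lemma coq_steps_reverse_set:
  assumes "finite S"
  shows "coq_step\<^sup>*\<^sup>* (Q, \<sigma>) (reverse_set S Q, \<sigma>)"
  using assms
proof (induction S)
  case empty
  show ?case by (simp add: reverse_set_def)
next
  case (insert v S)
  have "coq_step (reverse_set S Q, \<sigma>) (reverse_set (insert v S) Q, \<sigma>)"
    using insert.hyps(2) by (auto simp: reverse_set_insert coq_step_def intro: reversal.intros)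
  thus ?case using insert.IH by simp
qed

section \<open>Artin generators in terms of signed arrows\<close>

lemma signed_arrows_enc:
  assumes "(Q, \<tau>) \<in> LOQ"
  shows "signed_arrows Q v w = fst (enc (Q, \<tau>)) w v - fst (enc (Q, \<tau>)) v w"
proof -
  have lin: "\<tau> \<in> linear_orderings" using assms by (simp add: LOQ_def)
  show ?thesis
    by (cases rule: position_less_cases[OF lin, of v w])
      (auto simp: enc_def signed_arrows_swap[of Q w v])
qed

text \<open>For a fixed coefficient, \<open>transvect\<close> is congruence by a fixed matrix, so it
  is linear in the form and commutes with transposition.\<close>

lemma transvect_skew:
  "transvect c x y (\<lambda>v w. f w v - f v w) = (\<lambda>v w. transvect c x y f w v - transvect c x y f v w)"
  by (auto simp: transvect_def fun_eq_iff algebra_simps)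

lemma artin_op_signed_arrows:
  fixes Q :: "'v::finite quiver"
  assumes L: "(Q, \<tau>) \<in> LOQ" and k: "Suc k < CARD('v)"
  obtains Q' where "artin_op k (Q, \<tau>) = (Q', switch k \<tau>)" "quiver Q'"
    "signed_arrows Q' = transvect (- signed_arrows Q (\<tau> ! k) (\<tau> ! Suc k)) (\<tau> ! k) (\<tau> ! Suc k) (signed_arrows Q)"
proof -
  let ?x = "\<tau> ! k" and ?y = "\<tau> ! Suc k"
  define f where "f = fst (enc (Q, \<tau>))"
  have f: "enc (Q, \<tau>) = (f, \<tau>)" by (simp add: f_def enc_def)
  have g: "Artin k \<in> sbgens CARD('v)" using k by (simp add: sbgens_def)
  have e: "enc (artin_op k (Q, \<tau>)) = (transvect (f ?x ?y) ?x ?y f, switch k \<tau>)"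
    using enc_gen_op[OF L g] by (simp add: f artin_form_def Let_def)
  obtain Q' \<tau>' where a: "artin_op k (Q, \<tau>) = (Q', \<tau>')" by (cases "artin_op k (Q, \<tau>)")
  hence t: "\<tau>' = switch k \<tau>" using e by (simp add: enc_def)
  have L': "(Q', switch k \<tau>) \<in> LOQ" using gen_op_LOQ[OF L g] by (simp add: a t)
  have s: "signed_arrows Q = (\<lambda>v w. f w v - f v w)"
    using signed_arrows_enc[OF L] by (simp add: f fun_eq_iff)
  \<comment> \<open>\<open>?x\<close> precedes \<open>?y\<close> in the ordering, so the form
    vanishes at this pair and the coefficient of the transvection can be read off from the signed
    count.\<close>
  have "f ?y ?x = 0"
    using unitri_enc[OF L] k by (auto simp: f intro: unitri_nth)
  hence c: "- signed_arrows Q ?x ?y = f ?x ?y" by (simp add: s)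
  have "signed_arrows Q' = (\<lambda>v w. transvect (f ?x ?y) ?x ?y f w v - transvect (f ?x ?y) ?x ?y f v w)"
    using signed_arrows_enc[OF L'] e by (simp add: a t fun_eq_iff)
  hence "signed_arrows Q' = transvect (- signed_arrows Q ?x ?y) ?x ?y (signed_arrows Q)"
    unfolding c unfolding s transvect_skew .
  thus ?thesis using that a t L' by (simp add: LOQ_def)
qed

section \<open>Generators as sequences of steps\<close>

text \<open>Once arrows leave \<open>x\<close> only towards \<open>y\<close>, mutation at
  \<open>x\<close> adds only composites \<open>v\<close> \<rightarrow> \<open>x\<close>
  \<rightarrow> \<open>y\<close>. Hence, away from \<open>x\<close>, only counts at \<open>y\<close>
  change, by multiples of the counts at \<open>x\<close>, as under the transvection; the reversal at
  \<open>x\<close> restores the arrows at \<open>x\<close> itself.\<close>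

lemma artin_steps:
  fixes Q :: "'v::finite quiver"
  assumes L: "(Q, \<tau>) \<in> LOQ" and k: "Suc k < CARD('v)"
  shows "coq_step\<^sup>*\<^sup>* (Q, cyclic_class \<tau>) (map_prod id cyclic_class (artin_op k (Q, \<tau>)))"
proof -
  have q: "quiver Q" and lin: "\<tau> \<in> linear_orderings" using L by (auto simp: LOQ_def)
  have k': "Suc k < length \<tau>" using k length_linear_ordering[OF lin] by simp
  define x y where xy: "x = \<tau> ! k" "y = \<tau> ! Suc k"
  define A B where "A = take k \<tau>" "B = drop (Suc (Suc k)) \<tau>"
  hence \<tau>: "\<tau> = A @ x # y # B" and A: "length A = k"
    using k' by (simp_all add: xy Cons_nth_drop_Suc)
  have sw: "switch k \<tau> = A @ y # x # B"
    unfolding \<tau> switch_def by (simp add: A[symmetric] list_update_append nth_append)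
  \<comment> \<open>Cut the circle open at \<open>x\<close>, so that \<open>x\<close> has to pass
    exactly the list \<open>[y]\<close>.\<close>
  have lin1: "x # [y] @ (B @ A) \<in> linear_orderings"
    using lin unfolding \<tau> by (auto simp: linear_orderings_def)
  have lin2: "A @ y # x # B \<in> linear_orderings"
    using switch_linear[OF lin k'] by (simp add: sw)
  have c1: "cyclic_class \<tau> = cyclic_class (x # [y] @ (B @ A))"
    using cyclic_class_append_swap[of A "x # y # B"] lin by (simp add: \<tau>)
  have c2: "cyclic_class (switch k \<tau>) = cyclic_class ([y] @ x # (B @ A))"
    using cyclic_class_append_swap[of A "y # x # B"] lin2 by (simp add: sw)
  obtain Q' where Q': "artin_op k (Q, \<tau>) = (Q', switch k \<tau>)" "quiver Q'"
    "signed_arrows Q' = transvect (- signed_arrows Q x y) x y (signed_arrows Q)"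
    using artin_op_signed_arrows[OF L k] unfolding xy by blast
  \<comment> \<open>As \<open>x\<close> is outside \<open>S\<close>, each \<open>w\<close> in
    \<open>S\<close> has its arrows to or from \<open>x\<close> flipped. Afterwards arrows between
    \<open>x\<close> and \<open>y\<close> leave \<open>x\<close>, and all others at \<open>x\<close>
    enter it.\<close>
  define S where "S = {w. if w = y then arrow Q y x else arrow Q x w}"
  have xny: "x \<noteq> y" using lin1 by (simp add: linear_orderings_def)
  have xS: "x \<notin> S" using q xny by (auto simp: S_def arrow_def quiver_def)
  define R where "R = reverse_set S Q"
  have qR: "quiver R" unfolding R_def using q by (rule quiver_reverse_set)
  have R0: "R x w = 0" if "w \<noteq> y" for w
  proof -
    have "Q x w = 0 \<or> Q w x = 0" using q by (simp add: quiver_def)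
    thus ?thesis using that xS by (auto simp: R_def reverse_set_def S_def arrow_def)
  qed
  have Ry: "R y x = 0"
  proof -
    have "Q x y = 0 \<or> Q y x = 0" using q by (simp add: quiver_def)
    thus ?thesis using xS by (auto simp: R_def reverse_set_def S_def arrow_def)
  qed
  have out: "Out R x \<subseteq> set [y]" "In R x \<inter> set [y] = {}"
    using R0 Ry unfolding Out_def In_def arrow_def by (auto, metis less_numeral_extra(3))
  let ?P = "reverse_set S (reverse_at x (mutation x R))"
  have "?P = Q'"
  proof (rule quiver_eqI)
    show "quiver ?P" by (intro quiver_reverse_set quiver_reverse_at quiver_mutation)
    fix v w
    \<comment> \<open>The diagonal signs relating \<open>Q\<close> and \<open>R\<close>. Since
      \<open>\<epsilon> x = 1\<close>, the product of the counts along \<open>v\<close>,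
      \<open>x\<close>, \<open>w\<close> picks up the same sign as the count from \<open>v\<close>
      to \<open>w\<close>, so the correction terms agree.\<close>
    define \<epsilon> where "\<epsilon> = (\<lambda>v. if v \<in> S then -1 else 1 :: int)"
    have \<epsilon>: "\<epsilon> u * \<epsilon> u = 1" "\<epsilon> x = 1" for u using xS by (auto simp: \<epsilon>_def)
    have Q: "signed_arrows Q u u' = \<epsilon> u * \<epsilon> u' * signed_arrows R u u'" for u u'
      using signed_arrows_reverse_set[of S R u u'] by (simp add: R_def reverse_set_reverse_set \<epsilon>_def)
    have P: "signed_arrows ?P v w = \<epsilon> v * \<epsilon> w * (if v = x \<or> w = x then signed_arrows R v w
      else signed_arrows R v w + int (R v x * R x w) - int (R w x * R x v))"
      by (simp add: signed_arrows_reverse_set signed_arrows_reverse_at signed_arrows_mutation[OF qR] \<epsilon>_def)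
    have sx: "signed_arrows R x y = int (R x y)" "signed_arrows R y x = - int (R x y)"
      "signed_arrows R x x = 0"
      "u \<noteq> y \<Longrightarrow> signed_arrows R x u = - int (R u x)" "u \<noteq> y \<Longrightarrow> signed_arrows R u x = int (R u x)" for u
      using Ry R0[of u] by (auto simp: signed_arrows_def)
    have \<epsilon>3: "\<epsilon> u * (\<epsilon> u * a) = a" for u a using \<epsilon>(1)[of u] by (simp flip: mult.assoc)
    show "signed_arrows ?P v w = signed_arrows Q' v w"
      unfolding P Q'(3) transvect_def Q
      using xny R0[of v] R0[of w] Ry
      by (auto simp: \<epsilon> \<epsilon>3 sx algebra_simps)
  qed (rule Q'(2))
  have "coq_step\<^sup>*\<^sup>* (Q, cyclic_class \<tau>) (R, cyclic_class \<tau>)"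
    unfolding R_def by (rule coq_steps_reverse_set) simp
  moreover have "coq_step (R, cyclic_class \<tau>) (mutation x R, cyclic_class (switch k \<tau>))"
    unfolding c1 c2 coq_step_def using proper_mutation_class[OF lin1 qR out] by blast
  moreover have "coq_step (mutation x R, cyclic_class (switch k \<tau>))
    (reverse_at x (mutation x R), cyclic_class (switch k \<tau>))"
    by (simp add: coq_step_def reversal.intros)
  moreover have "coq_step\<^sup>*\<^sup>* (reverse_at x (mutation x R), cyclic_class (switch k \<tau>))
    (Q', cyclic_class (switch k \<tau>))"
    unfolding \<open>?P = Q'\<close>[symmetric] by (rule coq_steps_reverse_set) simp
  ultimately have "coq_step\<^sup>*\<^sup>* (Q, cyclic_class \<tau>) (Q', cyclic_class (switch k \<tau>))"
    by (meson rtranclp.rtrancl_into_rtrancl rtranclp_trans)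
  thus ?thesis by (simp add: Q'(1))
qed

section \<open>From generators to words and orbits of the group\<close>

lemma gen_op_steps:
  fixes X :: "'v::finite loq"
  assumes "X \<in> LOQ" "g \<in> sbgens CARD('v)"
  shows "coq_step\<^sup>*\<^sup>* (map_prod id cyclic_class X) (map_prod id cyclic_class (gen_op g X))"
proof (cases X)
  case (Pair Q \<tau>)
  show ?thesis
  proof (cases g)
    case (Artin k)
    thus ?thesis using artin_steps[of Q \<tau> k] assms by (simp add: Pair sbgens_def)
  next
    case (Sign i)
    have "coq_step (Q, cyclic_class \<tau>) (reverse_at (\<tau> ! i) Q, cyclic_class \<tau>)"
      by (simp add: coq_step_def reversal.intros)
    thus ?thesis by (simp add: Pair Sign sign_op_def r_into_rtranclp)
  qed
qed

lemma letter_bij_steps: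
  fixes X :: "'v::finite loq"
  assumes X: "X \<in> LOQ" and g: "fst l \<in> sbgens CARD('v)"
  shows "letter_bij l X \<in> LOQ"
    and "coq_step\<^sup>*\<^sup>* (map_prod id cyclic_class X) (map_prod id cyclic_class (letter_bij l X))"
proof -
  let ?c = "map_prod id cyclic_class :: 'v loq \<Rightarrow> 'v coq"
  obtain g b where l: "l = (g, b)" by (cases l)
  have g: "g \<in> sbgens CARD('v)" using g by (simp add: l)
  have bij: "(gen_bij g :: 'v loq \<Rightarrow> 'v loq) \<in> Bij LOQ" by (rule gen_bij_Bij[OF g])
  have "letter_bij l X \<in> LOQ \<and> coq_step\<^sup>*\<^sup>* (?c X) (?c (letter_bij l X))"
  proof (cases b)
    case True
    thus ?thesis
      using gen_op_steps[OF X g] gen_op_LOQ[OF X g] X by (simp add: l letter_bij_def gen_bij_def)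
  next
    case False
    \<comment> \<open>The inverse letter sends \<open>X\<close> to its preimage \<open>Y\<close>.
      The generator gives steps from \<open>Y\<close> to \<open>X\<close>, which are then run
      backwards.\<close>
    define Y where "Y = inv_into LOQ (gen_bij g) X"
    have Y': "letter_bij l X = Y"
      using X False by (simp add: l letter_bij_def inv_BijGroup[OF bij] Y_def)
    have im: "X \<in> gen_bij g ` LOQ" using bij X by (simp add: Bij_def bij_betw_def)
    have Y: "Y \<in> LOQ" unfolding Y_def by (rule inv_into_into[OF im])
    have "gen_op g Y = X"
      using f_inv_into_f[OF im] Y unfolding Y_def[symmetric] by (simp add: gen_bij_def)
    hence "coq_step\<^sup>*\<^sup>* (?c Y) (?c X)" using gen_op_steps[OF Y g] by simp
    moreover have "?c Y \<in> COQ" using Y by (cases Y) (simp add: COQ_class)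
    ultimately show ?thesis using coq_steps_sym Y by (simp add: Y')
  qed
  thus "letter_bij l X \<in> LOQ" "coq_step\<^sup>*\<^sup>* (?c X) (?c (letter_bij l X))" by auto
qed

lemma word_bij_steps:
  fixes X :: "'v::finite loq"
  assumes "w \<in> sbwords CARD('v)" "X \<in> LOQ"
  shows "word_bij w X \<in> LOQ \<and>
    coq_step\<^sup>*\<^sup>* (map_prod id cyclic_class X) (map_prod id cyclic_class (word_bij w X))"
  using assms(1)
proof (induction w)
  case Nil
  show ?case using assms(2) by (simp add: word_bij_Nil BijGroup_def)
next
  case (Cons l w)
  have lw: "fst l \<in> sbgens CARD('v)" "w \<in> sbwords CARD('v)" using Cons.prems by (auto simp: sbwords_def)
  have w: "word_bij w X \<in> LOQ"
    and IH: "coq_step\<^sup>*\<^sup>* (map_prod id cyclic_class X) (map_prod id cyclic_class (word_bij w X))"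
    using Cons.IH[OF lw(2)] by blast+
  \<comment> \<open>The head letter acts last, so its steps extend the path at its far end.\<close>
  have eq: "word_bij (l # w) X = letter_bij l (word_bij w X)"
    using letter_bij_Bij[where 'v = 'v, OF lw(1)] word_bij_Bij[where 'v = 'v, OF lw(2)] assms(2)
    by (simp add: word_bij_Cons BijGroup_def compose_def)
  show ?case
    unfolding eq using letter_bij_steps[OF w lw(1)] rtranclp_trans[OF IH] by (intro conjI)
qed

lemma loq_orbit_steps:
  fixes X :: "'v::finite loq"
  assumes "X \<in> LOQ" "Y \<in> loq_orbit X"
  shows "coq_step\<^sup>*\<^sup>* (map_prod id cyclic_class X) (map_prod id cyclic_class Y)"
proof -
  obtain w where "w \<in> sbwords CARD('v)" "Y = word_bij w X"
    using assms(2) unfolding loq_orbit_def orbit_def carrier_signed_braid_group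
    by (auto simp: signed_braid_action_class)
  thus ?thesis using word_bij_steps assms(1) by blast
qed

section \<open>Steps stay in the orbit\<close>

lemma reverse_at_loq_orbit:
  fixes Q :: "'v::finite quiver"
  assumes "(Q, \<tau>) \<in> LOQ"
  shows "(reverse_at v Q, \<tau>) \<in> loq_orbit (Q, \<tau>)"
proof -
  have lin: "\<tau> \<in> linear_orderings" using assms by (simp add: LOQ_def)
  have "set [Sign (position \<tau> v)] \<subseteq> sbgens CARD('v)"
    using position(1)[OF lin, of v] length_linear_ordering[OF lin] by (simp add: sbgens_def)
  from loq_orbit_generators[OF this assms] show ?thesis
    by (simp add: sign_op_def position(2)[OF lin])
qed

text \<open>For non-adjacent vertices the transvection has coefficient 0, so the generator only
  switches them.\<close>

lemma wiggle_loq_orbit: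
  fixes Q :: "'v::finite quiver"
  assumes L: "(Q, a # b # ys) \<in> LOQ" and "\<not> adjacent Q a b"
  shows "(Q, b # a # ys) \<in> loq_orbit (Q, a # b # ys)"
proof -
  have lin: "a # b # ys \<in> linear_orderings" and q: "quiver Q" using L by (auto simp: LOQ_def)
  have n: "Suc 0 < CARD('v)" using length_linear_ordering[OF lin] by simp
  obtain Q' where Q': "artin_op 0 (Q, a # b # ys) = (Q', b # a # ys)" "quiver Q'"
    "signed_arrows Q' = transvect (- signed_arrows Q a b) a b (signed_arrows Q)"
    using artin_op_signed_arrows[OF L n] by (auto simp: switch_def)
  have "signed_arrows Q a b = 0"
    using assms(2) by (simp add: adjacent_def arrow_def signed_arrows_def)
  hence "Q' = Q" by (intro quiver_eqI[OF Q'(2) q]) (simp add: Q'(3) transvect_def)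
  moreover have "set [Artin 0] \<subseteq> sbgens CARD('v)" using n by (simp add: sbgens_def)
  ultimately show ?thesis using loq_orbit_generators[OF _ L, of "[Artin 0]"] Q'(1) by simp
qed

text \<open>Sweeping \<open>j\<close> past \<open>xs\<close> changes the signed count between
  \<open>v\<close> in \<open>xs\<close> and another vertex \<open>w\<close> outside
  \<open>xs\<close> by the number of paths \<open>w\<close> \<rightarrow> \<open>j\<close>
  \<rightarrow> \<open>v\<close>, as mutation does; counts within either side stay fixed. The sweep
  also keeps the counts at \<open>j\<close>, which mutation negates, so a reversal at
  \<open>j\<close> makes up the difference.\<close>

lemma mutation_loq_orbit:
  fixes Q :: "'v::finite quiver"
  assumes L: "(Q, j # xs @ ys) \<in> LOQ" and out: "Out Q j \<subseteq> set xs" "In Q j \<inter> set xs = {}"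
  shows "(mutation j Q, xs @ j # ys) \<in> loq_orbit (Q, j # xs @ ys)"
proof -
  let ?\<tau> = "j # xs @ ys" and ?\<tau>' = "xs @ j # ys"
  have lin: "?\<tau> \<in> linear_orderings" and q: "quiver Q" using L by (auto simp: LOQ_def)
  have len: "Suc (length xs + length ys) = CARD('v)" using length_linear_ordering[OF lin] by simp
  \<comment> \<open>\<open>foldr\<close> applies the last entry first: generator 0 acts first, and
    \<open>j\<close> moves right one place at a time.\<close>
  let ?gs = "map Artin (rev [0..<length xs])"
  have gs: "set ?gs \<subseteq> sbgens CARD('v)" by (auto simp: sbgens_def simp flip: len)
  define f where "f = fst (enc (Q, ?\<tau>))"
  have f: "enc (Q, ?\<tau>) = (f, ?\<tau>)" by (simp add: f_def enc_def)
  have u: "unitri (f, ?\<tau>)" using unitri_enc[OF L] by (simp add: f)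
  have d: "distinct ?\<tau>" using lin by (simp add: linear_orderings_def)
  have "foldr form_op ?gs (f, ?\<tau>) = foldr artin_form (rev [0..<length xs]) (f, ?\<tau>)"
    unfolding foldr_map by (simp add: comp_def form_op_def)
  hence e: "enc (foldr gen_op ?gs (Q, ?\<tau>)) = (reflect_all j (set xs) f, ?\<tau>')"
    using foldr_gen_op(2)[OF gs L] artin_form_sweep[of j "xs @ ys" f "length xs", OF d unitri_diag[OF u]]
    by (simp add: f)
  obtain P \<tau>'' where P: "foldr gen_op ?gs (Q, ?\<tau>) = (P, \<tau>'')"
    by (cases "foldr gen_op ?gs (Q, ?\<tau>)")
  have t: "\<tau>'' = ?\<tau>'" using e by (simp add: P enc_def)
  have LP: "(P, ?\<tau>') \<in> LOQ" using foldr_gen_op(1)[OF gs L] by (simp add: P t)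
  have s: "signed_arrows Q v w = f w v - f v w" for v w
    using signed_arrows_enc[OF L] by (simp add: f)
  \<comment> \<open>\<open>j\<close> comes first in the ordering, so its row of the form holds all
    its arrows and its column vanishes off the diagonal.\<close>
  have fj: "f v j = 0" "f j v = - signed_arrows Q j v" if "v \<noteq> j" for v
  proof -
    have "position ?\<tau> j = 0" by (rule position_eqI[OF lin]) auto
    moreover have "position ?\<tau> v \<noteq> position ?\<tau> j" using that position_eq_iff[OF lin] by simp
    ultimately show "f v j = 0" using u by (simp add: unitri_def)
    thus "f j v = - signed_arrows Q j v" by (simp add: s)
  qed
  have sj: "signed_arrows Q j v = int (Q j v)" "Q v j = 0" if "v \<in> set xs" for v
    using that out(2) by (auto simp: In_def arrow_def signed_arrows_def)
  have sj': "signed_arrows Q j v = - int (Q v j)" "Q j v = 0" if "v \<notin> set xs" for v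
    using that out(1) by (auto simp: Out_def arrow_def signed_arrows_def)
  have jxs: "j \<notin> set xs" using d by simp
  have "P = reverse_at j (mutation j Q)"
  proof (rule quiver_eqI)
    show "quiver P" using LP by (simp add: LOQ_def)
    show "quiver (reverse_at j (mutation j Q))" by (intro quiver_reverse_at quiver_mutation)
    fix v w
    have P': "signed_arrows P v w = reflect_all j (set xs) f w v - reflect_all j (set xs) f v w"
      using signed_arrows_enc[OF LP] e by (simp add: P t)
    have M: "signed_arrows (reverse_at j (mutation j Q)) v w = (if v = j \<or> w = j then f w v - f v w
      else f w v - f v w + int (Q v j * Q j w) - int (Q w j * Q j v))"
      by (simp add: signed_arrows_reverse_at signed_arrows_mutation[OF q] s)
    show "signed_arrows P v w = signed_arrows (reverse_at j (mutation j Q)) v w"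
      unfolding P' M reflect_all_def
      by (cases "v = j"; cases "w = j"; cases "v \<in> set xs"; cases "w \<in> set xs")
        (simp_all add: jxs fj sj sj' unitri_diag[OF u])
  qed
  hence "(reverse_at j (mutation j Q), ?\<tau>') \<in> loq_orbit (Q, ?\<tau>)"
    using loq_orbit_generators[OF gs L] by (simp add: P t)
  moreover have "(mutation j Q, ?\<tau>') \<in> loq_orbit (reverse_at j (mutation j Q), ?\<tau>')"
    using reverse_at_loq_orbit[of "reverse_at j (mutation j Q)" ?\<tau>' j] LP
    by (simp add: \<open>P = _\<close> reverse_at_reverse_at)
  ultimately show ?thesis using loq_orbit_trans[OF L] by blast
qed

text \<open>A mutation or wiggle is visible in a linear ordering cut open at the vertices it moves,
  so the representative depends on the step and only its existence is claimed.\<close>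

lemma coq_step_orbit:
  fixes X :: "'v::finite coq"
  assumes "coq_step X Y" "X \<in> COQ"
  shows "\<exists>\<tau>\<in>snd X. \<exists>\<tau>'\<in>snd Y. (fst Y, \<tau>') \<in> loq_orbit (fst X, \<tau>)"
proof -
  obtain Q \<sigma> where X: "X = (Q, \<sigma>)" by (cases X)
  have L: "(Q, \<tau>) \<in> LOQ" if "\<tau> \<in> \<sigma>" for \<tau>
    using COQ_linear[OF assms(2)[unfolded X]] that by (simp add: LOQ_def)
  consider j where "proper_mutation j X Y" | "reversal X Y" | "wiggle X Y"
    using assms(1) by (auto simp: coq_step_def)
  thus ?thesis
  proof cases
    case 1
    then obtain xs ys where *: "j # xs @ ys \<in> \<sigma>" "Out Q j \<subseteq> set xs" "In Q j \<inter> set xs = {}"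
      and Y: "Y = (mutation j Q, cyclic_class (xs @ j # ys))"
      unfolding X by (auto elim: proper_mutation.cases)
    show ?thesis
      unfolding X Y fst_conv snd_conv
      using mutation_loq_orbit[OF L[OF *(1)] *(2,3)] self_in_cyclic_class *(1) by (intro bexI)
  next
    case 2
    then obtain v where Y: "Y = (reverse_at v Q, \<sigma>)" unfolding X by (auto elim: reversal.cases)
    obtain \<tau> where "\<tau> \<in> \<sigma>"
      using assms(2) self_in_cyclic_class by (auto simp: X COQ_def cyclic_orderings_def)
    thus ?thesis using reverse_at_loq_orbit[OF L] by (auto simp: X Y)
  next
    case 3
    then obtain a b ys where *: "a # b # ys \<in> \<sigma>" "\<not> adjacent Q a b"
      and Y: "Y = (Q, cyclic_class (b # a # ys))"
      unfolding X by (auto elim: wiggle.cases)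
    show ?thesis
      unfolding X Y fst_conv snd_conv
      using wiggle_loq_orbit[OF L[OF *(1)] *(2)] self_in_cyclic_class *(1) by (intro bexI)
  qed
qed

lemma coq_orbit_step:
  fixes X :: "'v::finite coq"
  assumes X: "X \<in> COQ" and Y: "Y \<in> coq_orbit X" and step: "coq_step Y Z"
  shows "Z \<in> coq_orbit X"
proof -
  obtain Q \<sigma> where X': "X = (Q, \<sigma>)" by (cases X)
  obtain P \<rho> where Y': "Y = (P, \<rho>)" by (cases Y)
  obtain R \<pi> where Z': "Z = (R, \<pi>)" by (cases Z)
  have YC: "Y \<in> COQ" using Y by (auto simp: X' coq_orbit_def)
  have ZC: "Z \<in> COQ" using coq_step_COQ[OF step YC] .
  obtain \<tau>1 \<tau>2 where 1: "\<tau>1 \<in> \<rho>" "\<tau>2 \<in> \<pi>" "(R, \<tau>2) \<in> loq_orbit (P, \<tau>1)"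
    using coq_step_orbit[OF step YC] by (auto simp: Y' Z')
  obtain \<tau> where \<tau>: "\<tau> \<in> \<sigma>" using Y by (auto simp: X' coq_orbit_def)
  \<comment> \<open>Independence of representatives lets the orbit relation end at
    \<open>\<tau>1\<close>, the ordering from which the given step starts.\<close>
  have "(P, \<tau>1) \<in> loq_orbit (Q, \<tau>)"
    using coq_orbit_iff[of Q \<sigma> P \<rho> \<tau> \<tau>1] X Y YC \<tau> 1(1) by (simp add: X' Y')
  moreover have "(Q, \<tau>) \<in> LOQ" using COQ_linear[of Q \<sigma> \<tau>] X \<tau> by (simp add: X' LOQ_def)
  ultimately have "(R, \<tau>2) \<in> loq_orbit (Q, \<tau>)" using loq_orbit_trans 1(3) by blast
  thus ?thesis using coq_orbit_iff[of Q \<sigma> R \<pi> \<tau> \<tau>2] X ZC \<tau> 1(2) by (simp add: X' Z')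
qed

section \<open>Equality of the orbit with the set of reachable cyclically ordered quivers\<close>

theorem corollary19p3:
  fixes Q :: "'v::finite quiver" and \<sigma> :: "'v list set"
  assumes "(Q, \<sigma>) \<in> COQ"
  shows "coq_orbit (Q, \<sigma>) = {X. coq_step\<^sup>*\<^sup>* (Q, \<sigma>) X}"
proof (intro equalityI subsetI CollectI)
  fix X assume X: "X \<in> coq_orbit (Q, \<sigma>)"
  obtain Q' \<sigma>' where X': "X = (Q', \<sigma>')" by (cases X)
  obtain \<tau> \<tau>' where *: "\<tau> \<in> \<sigma>" "\<tau>' \<in> \<sigma>'" "(Q', \<tau>') \<in> loq_orbit (Q, \<tau>)" "(Q', \<sigma>') \<in> COQ"
    using X by (auto simp: X' coq_orbit_def)
  have "(Q, \<tau>) \<in> LOQ" using COQ_linear[OF assms *(1)] by (simp add: LOQ_def)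
  \<comment> \<open>The resulting path joins the rotation classes of \<open>\<tau>\<close> and
    \<open>\<tau>'\<close>, which are \<open>\<sigma>\<close> and \<open>\<sigma>'\<close>.\<close>
  from loq_orbit_steps[OF this *(3)]
  show "coq_step\<^sup>*\<^sup>* (Q, \<sigma>) X"
    using COQ_linear[OF assms *(1)] COQ_linear[OF *(4,2)] by (simp add: X')
next
  fix X assume "X \<in> {X. coq_step\<^sup>*\<^sup>* (Q, \<sigma>) X}"
  hence "coq_step\<^sup>*\<^sup>* (Q, \<sigma>) X" by simp
  thus "X \<in> coq_orbit (Q, \<sigma>)"
  proof (induction rule: rtranclp_induct)
    case base
    obtain \<tau> where \<tau>: "\<tau> \<in> \<sigma>"
      using assms self_in_cyclic_class by (auto simp: COQ_def cyclic_orderings_def)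
    hence "(Q, \<tau>) \<in> LOQ" using COQ_linear[OF assms] by (simp add: LOQ_def)
    thus ?case using coq_orbit_iff[OF assms assms \<tau> \<tau>] loq_orbit_refl by blast
  next
    case (step Y Z)
    thus ?case using coq_orbit_step[OF assms] by blast
  qed
qed

end
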